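(* Let $d\ge 2$, let $N=\binom{d+2}{2}$, and let $Z$ be a general set of $N-2$ points in $\mathbb{P}^3$ (over $\mathbb{C}$). Then the $d$-Weddle locus of $Z$ does not have the expected codimension (which is $3$).
   Context: "General" set of points means: for all sets corresponding to a nonempty Zariski open subset of the parameter space. For a finite set $Z=\{P_1,\dots,P_r\}\subset\mathbb{P}^3$ and $P\in\mathbb{P}^3\setminus Z$, let $\delta(P)=\dim_{\mathbb{C}}[I(Z)\cap I(P)^d]_d$, the dimension of the space of degree $d$ cones with vertex $P$ containing $Z$ (equivalently, of degree $d$ plane curves containing the projection of $Z$ from $P$). The $d$-Weddle locus of $Z$ is the Zariski closure of the set of $P\in\mathbb{P}^3\setminus Z$ at which $\delta(P)$ exceeds its minimal (generic) value. Expected codimension. Let $R=\mathbb{C}[x_0,\dots,x_3]$, let $L_i$ be the linear form dual to $P_i$ (i.e. $L_i=\sum_k p_kx_k$ if $P_i=[p_0:\dots:p_3]$) and $L_P$ the form dual to $P$. The $d$-Weddle locus is the degeneracy locus of multiplication $\times L_P:[R/(L_1^d,\dots,L_r^d)]_{d-1}\to[R/(L_1^d,\dots,L_r^d)]_d$, represented by a matrix of linear forms in the coordinates of $P$. For the locus defined by the $(k+1)\times(k+1)$ minors of a $q\times p$ matrix of linear forms, the expected codimension is $(p-k)(q-k)$. Here the two spaces have dimensions $\binom{d+2}{3}$ and $\binom{d+2}{3}+2$, so for maximal minors the expected codimension is $3$. *)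

theory Defs
  imports "HOL-Analysis.Analysis" "HOL-Library.Poly_Mapping"
begin

section \<open>Polynomials over the complex numbers\<close>

text \<open>
  Polynomials in variables indexed by \<open>'v\<close>: finitely supported coefficient functions on
  exponent vectors, with the convolution product of \<^theory>\<open>HOL-Library.Poly_Mapping\<close>.
\<close>

type_synonym 'v cpoly = "('v \<Rightarrow>\<^sub>0 nat) \<Rightarrow>\<^sub>0 complex"

definition const_poly :: "complex \<Rightarrow> 'v cpoly" where
  "const_poly c = Poly_Mapping.single 0 c"

definition var_poly :: "'v \<Rightarrow> 'v cpoly" where
  "var_poly i = Poly_Mapping.single (Poly_Mapping.single i 1) 1"

definition eval_poly :: "'v cpoly \<Rightarrow> ('v \<Rightarrow> complex) \<Rightarrow> complex" where
  "eval_poly f a = (\<Sum>m\<in>Poly_Mapping.keys f. Poly_Mapping.lookup f m *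
     (\<Prod>i\<in>Poly_Mapping.keys m. a i ^ Poly_Mapping.lookup m i))"

interpretation cpoly: vector_space "\<lambda>c (f :: 'v cpoly). const_poly c * f"
  by unfold_locales
    (auto simp: const_poly_def algebra_simps single_add mult_single simp flip: mult.assoc)

text \<open>A commutative ring as a module over itself: its submodules are the ideals, and
  \<open>ideal.span S\<close> is the ideal generated by \<open>S\<close>.\<close>

interpretation ideal: module "(*) :: 'a \<Rightarrow> 'a \<Rightarrow> 'a :: comm_ring_1"
  by unfold_locales (simp_all add: algebra_simps)

fun ideal_power :: "'a :: comm_ring_1 set \<Rightarrow> nat \<Rightarrow> 'a set" where
  "ideal_power I 0 = UNIV"
| "ideal_power I (Suc n) = ideal.span {a * b | a b. a \<in> I \<and> b \<in> ideal_power I n}"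

text \<open>\<open>R = \<complex>[x\<^sub>0, \<dots>, x\<^sub>3]\<close>; the index type \<open>4\<close> consists of \<open>0, 1, 2, 3\<close>.\<close>

type_synonym R = "4 cpoly"

text \<open>\<open>[R]\<^sub>t\<close>, the forms of degree \<open>t\<close> (including \<open>0\<close>).\<close>

definition forms :: "nat \<Rightarrow> R set" where
  "forms t = {f. \<forall>m\<in>Poly_Mapping.keys f. (\<Sum>i\<in>UNIV. Poly_Mapping.lookup m i) = t}"

text \<open>For a homogeneous ideal \<open>J\<close>, the graded piece \<open>[R/J]\<^sub>t\<close> is \<open>[R]\<^sub>t / (J \<inter> [R]\<^sub>t)\<close>;
  both spaces are finite-dimensional.\<close>

definition dim_quotient_piece :: "R set \<Rightarrow> nat \<Rightarrow> nat" where
  "dim_quotient_piece J t = cpoly.dim (forms t) - cpoly.dim (J \<inter> forms t)"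


section \<open>Projective space and the Zariski topology\<close>

text \<open>Points of \<open>\<complex>\<P>\<^sup>3\<close> are the lines through the origin of \<open>\<complex>\<^sup>4\<close>; the nonzero elements of
  \<open>line_of P\<close> are the homogeneous coordinate vectors of \<open>P\<close>.\<close>

typedef P3 = "{vec.span {v} | v :: complex ^ 4. v \<noteq> 0}"
  morphisms line_of point_of_line
proof -
  have "(axis 0 1 :: complex ^ 4) \<noteq> 0"
    by (simp add: axis_eq_0_iff)
  then show ?thesis
    by blast
qed

definition vanishes_at :: "R \<Rightarrow> P3 \<Rightarrow> bool" where
  "vanishes_at f P \<longleftrightarrow> (\<forall>v\<in>line_of P. eval_poly f (($) v) = 0)"

text \<open>The loci \<open>f \<noteq> 0\<close>, for \<open>f\<close> homogeneous, form a base of the Zariski topology.\<close>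

definition zariski :: "P3 topology" where
  "zariski = topology_generated_by {{P. \<not> vanishes_at f P} | f. \<exists>t. f \<in> forms t}"

definition irreducible_closed :: "P3 set \<Rightarrow> bool" where
  "irreducible_closed Y \<longleftrightarrow> Y \<noteq> {} \<and> closedin zariski Y \<and>
     (\<forall>A B. closedin zariski A \<and> closedin zariski B \<and> Y = A \<union> B \<longrightarrow> Y = A \<or> Y = B)"

text \<open>Krull dimension of a closed subset; the empty set gets dimension \<open>-\<infinity>\<close>.\<close>

definition zariski_dim :: "P3 set \<Rightarrow> ereal" where
  "zariski_dim X = Sup {ereal (real n) | n. \<exists>Y :: nat \<Rightarrow> P3 set.
     (\<forall>i\<le>n. irreducible_closed (Y i) \<and> Y i \<subseteq> X) \<and> (\<forall>i<n. Y i \<subset> Y (Suc i))}"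

text \<open>\<open>3\<close> is the dimension of the ambient \<open>\<complex>\<P>\<^sup>3\<close>; the empty set gets codimension \<open>\<infinity>\<close>.\<close>

definition codim :: "P3 set \<Rightarrow> ereal" where
  "codim X = 3 - zariski_dim X"


section \<open>General sets of points\<close>

text \<open>
  \<open>(\<complex>\<P>\<^sup>3)\<^sup>r\<close> as the set of lists of length \<open>r\<close>. Its Zariski topology has the loci \<open>F \<noteq> 0\<close> as a base,
  where \<open>F\<close> is multihomogeneous: a polynomial in variables indexed by \<open>(i, k)\<close> (the \<open>k\<close>-th
  coordinate of the \<open>i\<close>-th point, \<open>i < r\<close>), homogeneous of some degree \<open>e i\<close> in each group
  of variables \<open>(i, _)\<close>.
\<close>

definition multihomogeneous :: "nat \<Rightarrow> (nat \<times> 4) cpoly \<Rightarrow> bool" where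
  "multihomogeneous r F \<longleftrightarrow> (\<exists>e. \<forall>m\<in>Poly_Mapping.keys F.
     (\<forall>i<r. (\<Sum>k\<in>UNIV. Poly_Mapping.lookup m (i, k)) = e i) \<and>
     (\<forall>i\<ge>r. \<forall>k. Poly_Mapping.lookup m (i, k) = 0))"

definition vanishes_at_tuple :: "(nat \<times> 4) cpoly \<Rightarrow> P3 list \<Rightarrow> bool" where
  "vanishes_at_tuple F ps \<longleftrightarrow>
     (\<forall>v :: nat \<Rightarrow> complex ^ 4. (\<forall>i<length ps. v i \<in> line_of (ps ! i)) \<longrightarrow>
        eval_poly F (\<lambda>(i, k). v i $ k) = 0)"

definition zariski_tuples :: "nat \<Rightarrow> P3 list topology" where
  "zariski_tuples r = topology_generated_by
     {{ps. length ps = r \<and> \<not> vanishes_at_tuple F ps} | F. multihomogeneous r F}"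

text \<open>The parameter space of sets of \<open>r\<close> points is the open subset of \<open>(\<complex>\<P>\<^sup>3)\<^sup>r\<close> of tuples of
  distinct points.\<close>

definition holds_for_general_set :: "nat \<Rightarrow> (P3 set \<Rightarrow> bool) \<Rightarrow> bool" where
  "holds_for_general_set r Q \<longleftrightarrow>
     (\<exists>U. openin (zariski_tuples r) U \<and> U \<noteq> {} \<and> (\<forall>ps\<in>U. distinct ps \<and> Q (set ps)))"


section \<open>Weddle loci\<close>

definition vanishing_ideal :: "P3 set \<Rightarrow> R set" where
  "vanishing_ideal Z = ideal.span {f. (\<exists>t. f \<in> forms t) \<and> (\<forall>P\<in>Z. vanishes_at f P)}"

definition weddle_delta :: "nat \<Rightarrow> P3 set \<Rightarrow> P3 \<Rightarrow> nat" where
  "weddle_delta d Z P =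
     cpoly.dim (vanishing_ideal Z \<inter> ideal_power (vanishing_ideal {P}) d \<inter> forms d)"

definition weddle_locus :: "nat \<Rightarrow> P3 set \<Rightarrow> P3 set" where
  "weddle_locus d Z = zariski closure_of
     {P. P \<notin> Z \<and> weddle_delta d Z P > (INF Q\<in>-Z. weddle_delta d Z Q)}"


section \<open>Expected codimension\<close>

definition dual_form :: "complex ^ 4 \<Rightarrow> R" where
  "dual_form v = (\<Sum>k\<in>UNIV. const_poly (v $ k) * var_poly k)"

text \<open>\<open>(L\<^sub>1\<^sup>d, \<dots>, L\<^sub>r\<^sup>d)\<close>: each \<open>L\<^sub>i\<close> is only determined up to a scalar, and taking all coordinate
  vectors of the points as generators yields the same ideal.\<close>

definition power_ideal :: "nat \<Rightarrow> P3 set \<Rightarrow> R set" where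
  "power_ideal d Z = ideal.span {dual_form v ^ d | v P. P \<in> Z \<and> v \<in> line_of P \<and> v \<noteq> 0}"

text \<open>Expected codimension of the locus cut out by the \<open>(k+1) \<times> (k+1)\<close> minors of a \<open>q \<times> p\<close>
  matrix of linear forms (used for \<open>k \<le> min p q\<close>).\<close>

definition expected_codim_minors :: "nat \<Rightarrow> nat \<Rightarrow> nat \<Rightarrow> nat" where
  "expected_codim_minors q p k = (p - k) * (q - k)"

text \<open>The matrix is that of multiplication by \<open>L\<^sub>P\<close> from \<open>[R/(L\<^sub>1\<^sup>d, \<dots>, L\<^sub>r\<^sup>d)]\<^bsub>d-1\<^esub>\<close> to
  \<open>[R/(L\<^sub>1\<^sup>d, \<dots>, L\<^sub>r\<^sup>d)]\<^sub>d\<close>, and the minors are the maximal ones, so \<open>k + 1 = min p q\<close>.\<close>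

definition weddle_expected_codim :: "nat \<Rightarrow> P3 set \<Rightarrow> nat" where
  "weddle_expected_codim d Z =
     (let p = dim_quotient_piece (power_ideal d Z) (d - 1);
          q = dim_quotient_piece (power_ideal d Z) d
      in expected_codim_minors q p (min p q - 1))"

end

theory Submission
  imports Defs "Jordan_Normal_Form.Determinant"
begin

text \<open>
  Write \<open>r = N - 2\<close> and let \<open>Z\<close> consist of \<open>r\<close> points. A cone of degree \<open>d\<close> with vertex \<open>P\<close> is
  a form of degree \<open>d\<close> in the three coordinates of the projection from \<open>P\<close>. These cones form
  a space of dimension \<open>N\<close>, on which containing \<open>Z\<close> amounts to \<open>r\<close> linear conditions. If the
  conditions are independent, then \<open>\<delta>(P) = 2\<close>. If \<open>P\<close> lies on a secant line through two points
  of \<open>Z\<close>, these two points have the same projection from \<open>P\<close>, so at most \<open>r - 1\<close> of the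
  conditions are independent, and \<open>\<delta>(P) \<ge> 3\<close> (\<open>weddle_delta_on_secant\<close>). Hence
  the Weddle locus contains the secant lines of \<open>Z\<close> as soon as \<open>\<delta>\<close> takes a value at most 2. It
  then has dimension at least 1 (\<open>codim_closure_of_line_points\<close>), while codimension 3 would
  force dimension 0.

  One explicit genericity condition suffices. Choose \<open>r\<close> of the \<open>N\<close> monomials of degree \<open>d\<close> in the
  first three coordinates, and require the determinant of their values at the \<open>r\<close> points to be
  nonzero. This determinant is multihomogeneous in the coordinates of the points, so the
  condition is open; the points \<open>[1 : 2\<^sup>i : 2\<^bsup>(d+1)i\<^esup> : 0]\<close> satisfy it, because for them the
  matrix is a Vandermonde matrix. It has three consequences.
  \<^item> The points are distinct, since proportional coordinate vectors give proportional rows.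
  \<^item> At the fourth coordinate point, which is not in \<open>Z\<close>, the cones are the forms in the first three
    coordinates, and the columns being independent gives \<open>\<delta> \<le> 2\<close> (\<open>weddle_delta_axis_le\<close>).
  \<^item> The coefficients of \<open>L\<^sup>d\<close> are nonzero multiples of the values of the monomials at the point
    dual to \<open>L\<close>. The rows being independent therefore makes the powers \<open>L\<^sub>1\<^sup>d, \<dots>, L\<^sub>r\<^sup>d\<close>
    independent, which gives the two sizes of the multiplication matrix and the expected
    codimension 3 (\<open>dim_power_ideal\<close>, \<open>weddle_expected_codim_eq_3\<close>).
\<close>

(* The infix is needed for coordinates of points of complex four-space. *)
no_notation Matrix.vec_index (infixl \<open>$\<close> 100)

(* Reading ring multiplication as scalar multiplication declares left-associated products
   as simp normal form, against which mult.assoc loops. *)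
declare ideal.scale_scale [simp del]

section \<open>Evaluation of polynomials\<close>

definition monomial_value :: "('v \<Rightarrow> complex) \<Rightarrow> ('v \<Rightarrow>\<^sub>0 nat) \<Rightarrow> complex" where
  "monomial_value a m = (\<Prod>i\<in>Poly_Mapping.keys m. a i ^ Poly_Mapping.lookup m i)"

lemma monomial_value_superset:
  assumes "finite A" "Poly_Mapping.keys m \<subseteq> A"
  shows "monomial_value a m = (\<Prod>i\<in>A. a i ^ Poly_Mapping.lookup m i)"
  unfolding monomial_value_def
  by (rule prod.mono_neutral_left) (use assms in \<open>auto simp: in_keys_iff\<close>)

lemma monomial_value_add:
  "monomial_value a (m + n) = monomial_value a m * monomial_value a n"
proof -
  let ?A = "Poly_Mapping.keys m \<union> Poly_Mapping.keys n"
  have "finite ?A" "Poly_Mapping.keys (m + n) \<subseteq> ?A"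
    using keys_add[of m n] by auto
  then show ?thesis
    by (simp add: monomial_value_superset[of ?A] lookup_add power_add prod.distrib)
qed

lemma monomial_value_zero [simp]: "monomial_value a 0 = 1"
  by (simp add: monomial_value_def)

lemma eval_poly_superset:
  assumes "finite A" "Poly_Mapping.keys f \<subseteq> A"
  shows "eval_poly f a = (\<Sum>m\<in>A. Poly_Mapping.lookup f m * monomial_value a m)"
  unfolding eval_poly_def monomial_value_def
  by (rule sum.mono_neutral_left) (use assms in \<open>auto simp: in_keys_iff\<close>)

lemma eval_poly_single: "eval_poly (Poly_Mapping.single m c) a = c * monomial_value a m"
  by (simp add: eval_poly_def monomial_value_def)

lemma eval_poly_zero [simp]: "eval_poly 0 a = 0"
  by (simp add: eval_poly_def)

lemma eval_poly_one [simp]: "eval_poly 1 a = 1"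
  using eval_poly_single[of 0 1 a] by simp

lemma eval_const_poly [simp]: "eval_poly (const_poly c) a = c"
  by (simp add: const_poly_def eval_poly_single)

lemma eval_var_poly [simp]: "eval_poly (var_poly i) a = a i"
  by (simp add: var_poly_def eval_poly_single monomial_value_def)

lemma eval_poly_add: "eval_poly (f + g) a = eval_poly f a + eval_poly g a"
proof -
  let ?A = "Poly_Mapping.keys f \<union> Poly_Mapping.keys g"
  have "finite ?A" "Poly_Mapping.keys (f + g) \<subseteq> ?A"
    using keys_add[of f g] by auto
  then show ?thesis
    by (simp add: eval_poly_superset[of ?A] lookup_add distrib_right sum.distrib)
qed

lemma eval_poly_sum: "eval_poly (sum f A) a = (\<Sum>x\<in>A. eval_poly (f x) a)"
  by (induction A rule: infinite_finite_induct) (auto simp: eval_poly_add)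

lemma sum_single_keys:
  "f = (\<Sum>m\<in>Poly_Mapping.keys f. Poly_Mapping.single m (Poly_Mapping.lookup f m))"
  by (rule poly_mapping_eqI)
    (simp add: lookup_sum lookup_single when_def in_keys_iff sum.delta)

lemma eval_poly_mult: "eval_poly (f * g) a = eval_poly f a * eval_poly g a"
proof -
  have "f * g = (\<Sum>m\<in>Poly_Mapping.keys f. \<Sum>n\<in>Poly_Mapping.keys g.
      Poly_Mapping.single (m + n) (Poly_Mapping.lookup f m * Poly_Mapping.lookup g n))"
    unfolding mult_single[symmetric] sum_product[symmetric]
    using sum_single_keys[of f] sum_single_keys[of g] by (rule arg_cong2)
  also have "eval_poly \<dots> a = (\<Sum>m\<in>Poly_Mapping.keys f. \<Sum>n\<in>Poly_Mapping.keys g.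
      (Poly_Mapping.lookup f m * monomial_value a m) * (Poly_Mapping.lookup g n * monomial_value a n))"
    unfolding eval_poly_sum eval_poly_single monomial_value_add
    by (intro sum.cong refl) (simp only: ac_simps)
  also have "\<dots> = eval_poly f a * eval_poly g a"
    by (simp add: sum_product eval_poly_superset[OF finite_keys order_refl])
  finally show ?thesis .
qed

lemma eval_poly_uminus [simp]: "eval_poly (- f) a = - eval_poly f a"
  using eval_poly_add[of f "- f" a] by (simp add: eq_neg_iff_add_eq_0 add.commute)

lemma eval_poly_diff: "eval_poly (f - g) a = eval_poly f a - eval_poly g a"
  using eval_poly_add[of f "- g" a] by simp

lemma eval_poly_power: "eval_poly (f ^ n) a = eval_poly f a ^ n"
  by (induction n) (auto simp: eval_poly_mult)

lemma eval_poly_prod: "eval_poly (prod f A) a = (\<Prod>x\<in>A. eval_poly (f x) a)"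
  by (induction A rule: infinite_finite_induct) (auto simp: eval_poly_mult)

lemma lookup_const_poly_mult:
  "Poly_Mapping.lookup (const_poly c * f) m = c * Poly_Mapping.lookup f m"
proof -
  have "const_poly c * f = (\<Sum>n\<in>Poly_Mapping.keys f.
      Poly_Mapping.single n (c * Poly_Mapping.lookup f n))"
    using arg_cong[OF sum_single_keys[of f], of "\<lambda>h. const_poly c * h"]
    by (simp add: const_poly_def sum_distrib_left mult_single)
  then show ?thesis
    by (simp add: lookup_sum lookup_single when_def in_keys_iff sum.delta)
qed

section \<open>Forms and orders of vanishing\<close>

text \<open>
  The \<open>n\<close>-th power of the ideal generated by the variables in \<open>A\<close>, described through its monomials. For \<open>A\<close> the
  complement of \<open>{k}\<close> it consists of the polynomials vanishing to order \<open>n\<close> along the line of the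
  \<open>k\<close>-th coordinate point, and its forms of degree \<open>n\<close> are the cones with that point as vertex.
\<close>

definition order_at_least :: "'v set \<Rightarrow> nat \<Rightarrow> 'v cpoly set" where
  "order_at_least A n = {f. \<forall>m\<in>Poly_Mapping.keys f. n \<le> (\<Sum>i\<in>A. Poly_Mapping.lookup m i)}"

lemma order_at_leastD:
  "\<lbrakk>f \<in> order_at_least A n; Poly_Mapping.lookup f m \<noteq> 0\<rbrakk> \<Longrightarrow> n \<le> (\<Sum>i\<in>A. Poly_Mapping.lookup m i)"
  by (auto simp: order_at_least_def in_keys_iff)

lemma order_at_least_add:
  "\<lbrakk>f \<in> order_at_least A n; g \<in> order_at_least A n\<rbrakk> \<Longrightarrow> f + g \<in> order_at_least A n"
  using keys_add[of f g] by (auto simp: order_at_least_def)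

lemma order_at_least_mult:
  "\<lbrakk>f \<in> order_at_least A m; g \<in> order_at_least A n\<rbrakk> \<Longrightarrow> f * g \<in> order_at_least A (m + n)"
  using keys_mult[of f g]
  by (fastforce simp: order_at_least_def lookup_add sum.distrib intro: add_mono)

lemma order_at_least_0 [simp]: "order_at_least A 0 = UNIV"
  by (auto simp: order_at_least_def)

lemma zero_in_order_at_least [simp]: "0 \<in> order_at_least A n"
  by (auto simp: order_at_least_def)

lemma ideal_order_at_least: "ideal.subspace (order_at_least A n)"
  unfolding ideal.subspace_def
  using order_at_least_add order_at_least_mult[of _ A 0 _ n] by auto

lemma ideal_power_order_at_least:
  assumes "I \<subseteq> order_at_least A 1"
  shows "ideal_power I n \<subseteq> order_at_least A n"
proof (induction n)
  case (Suc n)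
  have "{a * b |a b. a \<in> I \<and> b \<in> ideal_power I n} \<subseteq> order_at_least A (Suc n)"
    using assms Suc order_at_least_mult[of _ A 1 _ n] by auto
  then show ?case
    using ideal.span_minimal[OF _ ideal_order_at_least] by simp
qed simp

lemma ideal_ideal_power: "ideal.subspace (ideal_power I n)"
  by (cases n) (auto simp: ideal.subspace_UNIV)

lemma ideal_power_SucI:
  "\<lbrakk>a \<in> I; b \<in> ideal_power I n\<rbrakk> \<Longrightarrow> a * b \<in> ideal_power I (Suc n)"
  by (auto intro: ideal.span_base)

lemma power_mult_in_ideal_power:
  "\<lbrakk>a \<in> I; b \<in> ideal_power I n\<rbrakk> \<Longrightarrow> a ^ k * b \<in> ideal_power I (k + n)"
proof (induction k)
  case (Suc k)
  then show ?case
    using ideal_power_SucI[of a I "a ^ k * b" "k + n"] by (simp add: mult.assoc)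
qed simp

lemma prod_powers_in_ideal_power:
  assumes "finite A" "\<And>i. i \<in> A \<Longrightarrow> a i \<in> I"
  shows "(\<Prod>i\<in>A. a i ^ e i) \<in> ideal_power I (\<Sum>i\<in>A. e i)"
  using assms
proof (induction A)
  case (insert i A)
  then show ?case
    using power_mult_in_ideal_power[of "a i" I "\<Prod>i\<in>A. a i ^ e i"] by simp
qed simp

lemma ideal_imp_subspace:
  assumes "ideal.subspace S" shows "cpoly.subspace S"
  using assms unfolding ideal.subspace_def cpoly.subspace_def by auto

lemma formsD:
  "\<lbrakk>f \<in> forms t; Poly_Mapping.lookup f m \<noteq> 0\<rbrakk> \<Longrightarrow> (\<Sum>i\<in>UNIV. Poly_Mapping.lookup m i) = t"
  by (auto simp: forms_def in_keys_iff)

lemma forms_add: "\<lbrakk>f \<in> forms t; g \<in> forms t\<rbrakk> \<Longrightarrow> f + g \<in> forms t"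
  using keys_add[of f g] by (auto simp: forms_def)

lemma forms_mult: "\<lbrakk>f \<in> forms s; g \<in> forms t\<rbrakk> \<Longrightarrow> f * g \<in> forms (s + t)"
  using keys_mult[of f g] by (fastforce simp: forms_def lookup_add sum.distrib)

lemma zero_in_forms [simp]: "0 \<in> forms t"
  by (simp add: forms_def)

lemma const_poly_in_forms: "const_poly c \<in> forms 0"
  by (simp add: forms_def const_poly_def)

lemma one_in_forms: "1 \<in> forms 0"
  by (simp add: forms_def)

lemma forms_scale: "f \<in> forms t \<Longrightarrow> const_poly c * f \<in> forms t"
  using forms_mult[OF const_poly_in_forms, of f t c] by simp

lemma subspace_forms: "cpoly.subspace (forms t)"
  unfolding cpoly.subspace_def using forms_add forms_scale by auto

lemma forms_diff: "\<lbrakk>f \<in> forms t; g \<in> forms t\<rbrakk> \<Longrightarrow> f - g \<in> forms t"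
  using cpoly.subspace_diff[OF subspace_forms] .

lemma var_poly_in_forms: "var_poly i \<in> forms 1"
  by (simp add: forms_def var_poly_def lookup_single when_def sum.delta)

lemma forms_sum: "(\<And>x. x \<in> A \<Longrightarrow> f x \<in> forms t) \<Longrightarrow> sum f A \<in> forms t"
  using cpoly.subspace_sum[OF subspace_forms] .

lemma forms_power: "f \<in> forms t \<Longrightarrow> f ^ n \<in> forms (n * t)"
  by (induction n) (auto simp: one_in_forms intro: forms_mult)

lemma forms_prod:
  assumes "finite A" "\<And>x. x \<in> A \<Longrightarrow> f x \<in> forms (t x)"
  shows "prod f A \<in> forms (\<Sum>x\<in>A. t x)"
  using assms by (induction A) (auto simp: one_in_forms intro: forms_mult)

lemma forms_subset_order_at_least: "forms t \<subseteq> order_at_least UNIV t"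
  by (auto simp: forms_def order_at_least_def)

lemma form_of_higher_order_eq_0:
  assumes "f \<in> forms t" "f \<in> order_at_least UNIV n" "t < n"
  shows "f = 0"
proof (rule poly_mapping_eqI)
  fix m show "Poly_Mapping.lookup f m = Poly_Mapping.lookup 0 m"
    using formsD[OF assms(1), of m] order_at_leastD[OF assms(2), of m] assms(3) by fastforce
qed

lemma monomial_value_scale:
  fixes m :: "'v::finite \<Rightarrow>\<^sub>0 nat"
  shows "monomial_value (\<lambda>i. c * a i) m = c ^ (\<Sum>i\<in>UNIV. Poly_Mapping.lookup m i) * monomial_value a m"
  by (simp add: monomial_value_superset[of UNIV] power_mult_distrib prod.distrib power_sum)

lemma eval_form_scale:
  assumes "f \<in> forms t"
  shows "eval_poly f (\<lambda>i. c * a i) = c ^ t * eval_poly f a"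
  using assms unfolding eval_poly_superset[OF finite_keys order_refl]
  by (auto simp: forms_def monomial_value_scale sum_distrib_left intro!: sum.cong)

lemma const_poly_mult_single: "const_poly c * Poly_Mapping.single m b = Poly_Mapping.single m (c * b)"
  by (simp add: const_poly_def mult_single)

lemma lookup_monomial_combination:
  assumes "finite S"
  shows "Poly_Mapping.lookup (\<Sum>m\<in>S. const_poly (c m) * Poly_Mapping.single m 1) n
    = (if n \<in> S then c n else 0)"
  using assms by (simp add: lookup_sum const_poly_mult_single lookup_single when_def)

section \<open>Dimension counts\<close>

lemma linear_cpolyI:
  assumes "\<And>f g. \<phi> (f + g) = \<phi> f + \<phi> g" "\<And>c f. \<phi> (const_poly c * f) = const_poly c * \<phi> f"
  shows "Vector_Spaces.linear (\<lambda>c (f :: 'v cpoly). const_poly c * f)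
    (\<lambda>c (f :: 'w cpoly). const_poly c * f) \<phi>"
  using assms by unfold_locales auto

text \<open>
  Projecting to the coefficients indexed by \<open>S\<close> is injective on \<open>V\<close>, so a basis of \<open>V\<close> maps to
  an independent family in the span of \<open>card S\<close> monomials.
\<close>

lemma dim_le_card_determining_coeffs:
  fixes V :: "'v cpoly set"
  assumes "cpoly.subspace V" "finite S"
    and "\<And>f. \<lbrakk>f \<in> V; \<forall>m\<in>S. Poly_Mapping.lookup f m = 0\<rbrakk> \<Longrightarrow> f = 0"
  shows "cpoly.dim V \<le> card S"
proof -
  define \<phi> :: "'v cpoly \<Rightarrow> 'v cpoly"
    where "\<phi> f = (\<Sum>m\<in>S. const_poly (Poly_Mapping.lookup f m) * Poly_Mapping.single m 1)" for f
  have lookup: "Poly_Mapping.lookup (\<phi> f) m = (if m \<in> S then Poly_Mapping.lookup f m else 0)" for f m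
    unfolding \<phi>_def by (rule lookup_monomial_combination) fact
  interpret lin: Vector_Spaces.linear "\<lambda>c (f :: 'v cpoly). const_poly c * f"
    "\<lambda>c (f :: 'v cpoly). const_poly c * f" \<phi>
    by (rule linear_cpolyI)
      (auto intro!: poly_mapping_eqI simp: lookup lookup_add lookup_const_poly_mult)
  obtain B where B: "B \<subseteq> V" "cpoly.independent B" "V \<subseteq> cpoly.span B" "card B = cpoly.dim V"
    using cpoly.basis_exists by blast
  have "inj_on \<phi> (cpoly.span B)"
  proof (subst lin.inj_on_iff_eq_0[OF cpoly.subspace_span], intro ballI impI)
    fix f assume f: "f \<in> cpoly.span B" "\<phi> f = 0"
    have "f \<in> V"
      using cpoly.span_minimal[OF B(1) assms(1)] f(1) by blast
    moreover have "\<forall>m\<in>S. Poly_Mapping.lookup f m = 0"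
      using lookup[of f] f(2) by (metis lookup_zero)
    ultimately show "f = 0"
      using assms(3) by blast
  qed
  then have ind: "cpoly.independent (\<phi> ` B)" and inj: "inj_on \<phi> B"
    using lin.independent_injective_image[OF B(2)] cpoly.span_superset inj_on_subset by blast+
  have "\<phi> ` B \<subseteq> cpoly.span ((\<lambda>m. Poly_Mapping.single m 1) ` S)"
    unfolding \<phi>_def
    by (intro image_subsetI cpoly.span_sum cpoly.span_scale) (blast intro: cpoly.span_base)
  then have "card (\<phi> ` B) \<le> card ((\<lambda>m. Poly_Mapping.single m (1::complex)) ` S)"
    using cpoly.independent_span_bound[OF _ ind] \<open>finite S\<close> by blast
  also have "\<dots> \<le> card S"
    using \<open>finite S\<close> by (rule card_image_le)
  finally show ?thesis
    using inj B(4) by (simp add: card_image)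
qed

text \<open>
  An infinite basis would count as dimension 0; the finite set \<open>W\<close> excludes this.
\<close>

lemma card_le_dim:
  fixes V :: "'v cpoly set"
  assumes "cpoly.independent B" "B \<subseteq> V" "V \<subseteq> cpoly.span W" "finite W"
  shows "card B \<le> cpoly.dim V"
proof -
  obtain C where C: "C \<subseteq> V" "cpoly.independent C" "V \<subseteq> cpoly.span C" "card C = cpoly.dim V"
    using cpoly.basis_exists by blast
  have "finite C"
    using cpoly.independent_span_bound[OF \<open>finite W\<close> C(2)] C(1) assms(3) by blast
  then show ?thesis
    using cpoly.independent_span_bound[OF _ assms(1)] assms(2) C(3,4) by (metis subset_trans)
qed

lemma independent_familyI:
  fixes f :: "'i \<Rightarrow> 'v cpoly"
  assumes "finite I"
    and "\<And>c. (\<Sum>i\<in>I. const_poly (c i) * f i) = 0 \<Longrightarrow> \<forall>i\<in>I. c i = 0"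
  shows "cpoly.independent (f ` I)" "inj_on f I"
proof -
  show inj: "inj_on f I"
  proof (rule inj_onI, rule ccontr)
    fix i j assume ij: "i \<in> I" "j \<in> I" "f i = f j" "i \<noteq> j"
    \<comment> \<open>A repeated member gives the relation with coefficients 1 and -1.\<close>
    define c :: "'i \<Rightarrow> complex" where "c k = (if k = i then 1 else if k = j then - 1 else 0)" for k
    have "(\<Sum>k\<in>I. const_poly (c k) * f k) = (\<Sum>k\<in>{i, j}. const_poly (c k) * f k)"
      by (rule sum.mono_neutral_right) (use ij \<open>finite I\<close> in \<open>auto simp: c_def const_poly_def\<close>)
    also have "\<dots> = 0"
      using ij by (simp add: c_def const_poly_def single_uminus)
    finally show False
      using assms(2)[of c] ij by (auto simp: c_def)
  qed
  show "cpoly.independent (f ` I)"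
  proof (rule cpoly.independent_if_scalars_zero)
    show "finite (f ` I)" using \<open>finite I\<close> by simp
    fix u x assume u: "(\<Sum>x\<in>f ` I. const_poly (u x) * x) = 0" and x: "x \<in> f ` I"
    have "(\<Sum>i\<in>I. const_poly (u (f i)) * f i) = 0"
      using u inj by (simp add: sum.reindex)
    from assms(2)[OF this] x show "u x = 0" by auto
  qed
qed

text \<open>
  Each vanishing condition costs at most one dimension. If a member \<open>b\<close> of the family does not
  vanish at \<open>a\<close>, subtracting suitable multiples of \<open>b\<close> from the other members makes them vanish at
  \<open>a\<close>, and this map has only the multiples of \<open>b\<close> in its kernel.
\<close>

lemma independent_vanishing_family:
  fixes B :: "'v cpoly set"
  assumes "finite A" "finite B" "cpoly.independent B"
  shows "\<exists>C. finite C \<and> cpoly.independent C \<and> C \<subseteq> cpoly.span B \<and>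
    (\<forall>f\<in>C. \<forall>a\<in>A. eval_poly f a = 0) \<and> card B \<le> card C + card A"
  using assms(1)
proof (induction A)
  case empty
  then show ?case
    using assms(2,3) cpoly.span_superset by (intro exI[of _ B]) auto
next
  case (insert a A)
  then obtain C where C: "finite C" "cpoly.independent C" "C \<subseteq> cpoly.span B"
    "\<forall>f\<in>C. \<forall>a\<in>A. eval_poly f a = 0" "card B \<le> card C + card A"
    by blast
  show ?case
  proof (cases "\<forall>f\<in>C. eval_poly f a = 0")
    case True
    then show ?thesis
      using C insert by (intro exI[of _ C]) auto
  next
    case False
    then obtain b where b: "b \<in> C" "eval_poly b a \<noteq> 0" by blast
    define \<phi> where "\<phi> f = f - const_poly (eval_poly f a / eval_poly b a) * b" for f :: "'v cpoly"
    have const: "const_poly (x + y) = const_poly x + const_poly y"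
      "const_poly (x * y) = const_poly x * const_poly y" for x y :: complex
      by (simp_all add: const_poly_def single_add mult_single)
    interpret lin: Vector_Spaces.linear "\<lambda>c (f :: 'v cpoly). const_poly c * f"
      "\<lambda>c (f :: 'v cpoly). const_poly c * f" \<phi>
      by (rule linear_cpolyI)
        (simp_all add: \<phi>_def eval_poly_add eval_poly_mult add_divide_distrib const
          right_diff_distrib distrib_right mult.assoc flip: times_divide_eq_right del: cpoly.scale_scale)
    have ind: "cpoly.independent (C - {b})"
      using C(2) by (rule cpoly.independent_mono) auto
    have nb: "b \<notin> cpoly.span (C - {b})"
      using C(2) b(1) cpoly.dependent_def by blast
    have inj: "inj_on \<phi> (cpoly.span (C - {b}))"
    proof (subst lin.inj_on_iff_eq_0[OF cpoly.subspace_span], intro ballI impI)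
      fix f assume f: "f \<in> cpoly.span (C - {b})" "\<phi> f = 0"
      define c where "c = eval_poly f a / eval_poly b a"
      have fb: "f = const_poly c * b"
        using f(2) by (simp add: \<phi>_def c_def)
      have "c = 0"
      proof (rule ccontr)
        assume "c \<noteq> 0"
        then have "b = const_poly (1 / c) * f"
          unfolding fb by simp
        then show False
          using nb f(1) cpoly.span_scale by metis
      qed
      then show "f = 0"
        using fb by (simp add: const_poly_def)
    qed
    let ?D = "\<phi> ` (C - {b})"
    have "cpoly.independent ?D"
      using lin.independent_injective_image[OF ind inj] .
    moreover have "card ?D = card C - 1"
      using inj b(1) C(1) by (simp add: card_image inj_on_subset[OF _ cpoly.span_superset])
    moreover have "?D \<subseteq> cpoly.span B"
      using C(3) b(1) by (auto simp: \<phi>_def intro!: cpoly.span_diff cpoly.span_scale)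
    moreover have "\<forall>f\<in>?D. \<forall>x\<in>insert a A. eval_poly f x = 0"
      using C(4) b by (auto simp: \<phi>_def eval_poly_diff eval_poly_mult)
    moreover have "card C > 0"
      using b(1) C(1) card_gt_0_iff by blast
    ultimately show ?thesis
      using C(1,5) insert(1,2) by (intro exI[of _ ?D]) auto
  qed
qed

section \<open>Counting monomials\<close>

definition exponents :: "'v set \<Rightarrow> nat \<Rightarrow> ('v \<Rightarrow>\<^sub>0 nat) set" where
  "exponents A t = {m. Poly_Mapping.keys m \<subseteq> A \<and> (\<Sum>i\<in>A. Poly_Mapping.lookup m i) = t}"

text \<open>
  Stars and bars: once the variables are listed, an exponent vector is the list of its entries.
\<close>

lemma exponents_card:
  assumes "finite A" 
  shows "card (exponents A t) = (t + card A - 1) choose t" "finite (exponents A t)"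
proof -
  obtain xs where xs: "distinct xs" "set xs = A"
    using finite_distinct_list[OF assms] by blast
  let ?L = "{l :: nat list. length l = card A \<and> sum_list l = t}"
  let ?h = "\<lambda>m. map (Poly_Mapping.lookup m) xs"
  have len: "length xs = card A"
    using xs distinct_card by fastforce
  have bij: "bij_betw ?h (exponents A t) ?L"
  proof (rule bij_betw_imageI)
    show "inj_on ?h (exponents A t)"
    proof (rule inj_onI, rule poly_mapping_eqI)
      fix m n k assume mn: "m \<in> exponents A t" "n \<in> exponents A t" "?h m = ?h n"
      show "Poly_Mapping.lookup m k = Poly_Mapping.lookup n k"
      proof (cases "k \<in> A")
        case True then show ?thesis using mn(3) xs(2) by auto
      next
        case False
        then have "k \<notin> Poly_Mapping.keys m" "k \<notin> Poly_Mapping.keys n"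
          using mn(1,2) unfolding exponents_def by blast+
        then show ?thesis by (simp add: in_keys_iff)
      qed
    qed
    have sum: "sum_list (?h m) = (\<Sum>i\<in>A. Poly_Mapping.lookup m i)" for m
      using xs by (simp add: sum_list_distinct_conv_sum_set)
    show "?h ` exponents A t = ?L"
    proof (rule subset_antisym)
      show "?h ` exponents A t \<subseteq> ?L"
        using len by (auto simp: exponents_def sum)
      show "?L \<subseteq> ?h ` exponents A t"
      proof
        fix l assume l: "l \<in> ?L"
        define m where "m = (\<Sum>j<length xs. Poly_Mapping.single (xs ! j) (l ! j))"
        have look: "Poly_Mapping.lookup m (xs ! j) = l ! j" if "j < length xs" for j
        proof -
          have "Poly_Mapping.lookup m (xs ! j) = (\<Sum>i<length xs. if i = j then l ! i else 0)"
            unfolding m_def lookup_sum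
            by (rule sum.cong) (use that xs(1) in \<open>auto simp: lookup_single when_def nth_eq_iff_index_eq\<close>)
          then show ?thesis using that by simp
        qed
        have h: "?h m = l"
          by (rule nth_equalityI) (use l len look in auto)
        have "Poly_Mapping.keys m \<subseteq> (\<Union>j<length xs. Poly_Mapping.keys (Poly_Mapping.single (xs ! j) (l ! j)))"
          unfolding m_def by (rule keys_sum)
        also have "\<dots> \<subseteq> A"
          using xs(2) by (auto split: if_splits)
        finally have "m \<in> exponents A t"
          using l sum[of m] h by (auto simp: exponents_def)
        then show "l \<in> ?h ` exponents A t" using h by force
      qed
    qed
  qed
  show "card (exponents A t) = (t + card A - 1) choose t"
    using bij_betw_same_card[OF bij] card_length_sum_list[of "card A" t] by simp
  have "finite {l :: nat list. set l \<subseteq> {..t} \<and> length l = card A}"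
    by (rule finite_lists_length_eq) simp
  moreover have "?L \<subseteq> {l :: nat list. set l \<subseteq> {..t} \<and> length l = card A}"
    by (auto dest: member_le_sum_list)
  ultimately show "finite (exponents A t)"
    using bij_betw_finite[OF bij] finite_subset by blast
qed

lemma sum_lookup_exponents:
  fixes m :: "'v::finite \<Rightarrow>\<^sub>0 nat"
  assumes "m \<in> exponents A t"
  shows "(\<Sum>i\<in>UNIV. Poly_Mapping.lookup m i) = t"
proof -
  have "(\<Sum>i\<in>A. Poly_Mapping.lookup m i) = (\<Sum>i\<in>UNIV. Poly_Mapping.lookup m i)"
    by (rule sum.mono_neutral_left) (use assms in \<open>auto simp: exponents_def in_keys_iff\<close>)
  then show ?thesis
    using assms by (simp add: exponents_def)
qed

lemma exponents_subset_UNIV: "exponents A t \<subseteq> exponents (UNIV :: 'v::finite set) t"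
proof
  fix m assume "m \<in> exponents A t"
  from sum_lookup_exponents[OF this] show "m \<in> exponents UNIV t"
    by (simp add: exponents_def)
qed

lemma forms_eq_span: "forms t = cpoly.span ((\<lambda>m. Poly_Mapping.single m 1) ` exponents UNIV t)"
proof (rule subset_antisym)
  show "forms t \<subseteq> cpoly.span ((\<lambda>m. Poly_Mapping.single m 1) ` exponents UNIV t)"
  proof
    fix f assume f: "f \<in> forms t"
    have "f = (\<Sum>m\<in>Poly_Mapping.keys f. const_poly (Poly_Mapping.lookup f m) * Poly_Mapping.single m 1)"
      using sum_single_keys[of f] by (simp add: const_poly_mult_single)
    moreover have "\<dots> \<in> cpoly.span ((\<lambda>m. Poly_Mapping.single m 1) ` exponents UNIV t)"
      using f by (intro cpoly.span_sum cpoly.span_scale cpoly.span_base)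
        (auto simp: forms_def exponents_def)
    ultimately show "f \<in> cpoly.span ((\<lambda>m. Poly_Mapping.single m 1) ` exponents UNIV t)" by simp
  qed
  show "cpoly.span ((\<lambda>m. Poly_Mapping.single m 1) ` exponents UNIV t) \<subseteq> forms t"
    by (rule cpoly.span_minimal[OF _ subspace_forms]) (auto simp: forms_def exponents_def)
qed

lemma dim_forms: "cpoly.dim (forms t) = (t + 3) choose t"
proof -
  have "cpoly.independent ((\<lambda>m. Poly_Mapping.single m 1) ` exponents (UNIV :: 4 set) t)"
    and inj: "inj_on (\<lambda>m. Poly_Mapping.single m (1::complex)) (exponents (UNIV :: 4 set) t)"
  proof (rule_tac [!] independent_familyI)
    show fin: "finite (exponents (UNIV :: 4 set) t)" "finite (exponents (UNIV :: 4 set) t)"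
      by (simp_all add: exponents_card)
    fix c :: "(4 \<Rightarrow>\<^sub>0 nat) \<Rightarrow> complex"
    assume 0: "(\<Sum>m\<in>exponents UNIV t. const_poly (c m) * Poly_Mapping.single m 1) = 0"
    show "\<forall>m\<in>exponents UNIV t. c m = 0"
      using lookup_monomial_combination[OF fin(1), of c] unfolding 0 by (metis lookup_zero)
    then show "\<forall>m\<in>exponents UNIV t. c m = 0" .
  qed
  then show ?thesis
    unfolding forms_eq_span by (simp add: cpoly.dim_eq_card_independent card_image exponents_card eval_nat_numeral)
qed

lemma card_le_dim_of_forms:
  assumes "cpoly.independent B" "B \<subseteq> V" "V \<subseteq> forms t"
  shows "card B \<le> cpoly.dim V"
  by (rule card_le_dim[OF assms(1,2)]) (use assms(3) in \<open>auto simp: forms_eq_span exponents_card\<close>)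

section \<open>Points and the Zariski topology of projective space\<close>

definition point :: "complex ^ 4 \<Rightarrow> P3" where
  "point v = point_of_line (vec.span {v})"

lemma line_of_point: "v \<noteq> 0 \<Longrightarrow> line_of (point v) = range (\<lambda>c. c *s v)"
  unfolding point_def vec.span_singleton[symmetric]
  by (rule point_of_line_inverse) blast

lemma in_line_of_point: "v \<noteq> 0 \<Longrightarrow> v \<in> line_of (point v)"
  by (simp add: line_of_point) (metis rangeI vec.scale_one)

lemma point_exhaust: obtains v where "v \<noteq> 0" "P = point v"
  using line_of[of P] line_of_inverse[of P] unfolding point_def by force

lemma point_eqI: "\<lbrakk>v \<noteq> 0; v \<in> line_of P\<rbrakk> \<Longrightarrow> P = point v"
proof -
  assume v: "v \<noteq> 0" "v \<in> line_of P"
  obtain w where w: "w \<noteq> 0" "P = point w" by (rule point_exhaust)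
  then obtain c where c: "v = c *s w" using v by (auto simp: line_of_point)
  with v have "c \<noteq> 0" by auto
  have "range (\<lambda>x. x *s v) = range (\<lambda>x. x *s w)"
  proof (rule subset_antisym; rule subsetI)
    fix y assume "y \<in> range (\<lambda>x. x *s w)"
    then obtain x where "y = x *s w" by auto
    then have "y = (x / c) *s v" using c \<open>c \<noteq> 0\<close> by simp
    then show "y \<in> range (\<lambda>x. x *s v)" by blast
  qed (auto simp: c)
  then show "P = point v"
    unfolding w(2) point_def vec.span_singleton by simp
qed

lemma point_scale: "\<lbrakk>c \<noteq> 0; v \<noteq> 0\<rbrakk> \<Longrightarrow> point (c *s v) = point v"
  by (rule point_eqI[symmetric]) (auto simp: line_of_point)

lemma distinct_points_independent:
  assumes "v \<noteq> 0" "w \<noteq> 0" "point v \<noteq> point w" "x *s v + y *s w = 0"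
  shows "x = 0 \<and> y = 0"
proof (rule ccontr)
  assume "\<not> (x = 0 \<and> y = 0)"
  moreover have eq: "x *s v = (- y) *s w"
    unfolding vec.scale_minus_left eq_neg_iff_add_eq_0 by (rule assms(4))
  moreover have "x = 0 \<longleftrightarrow> y = 0"
    using assms(1,2) arg_cong[OF eq, of "\<lambda>u. u = 0"] unfolding vec.scale_eq_0_iff by simp
  ultimately have "x \<noteq> 0" "y \<noteq> 0"
    by blast+
  then have "point v = point (x *s v)" "point w = point ((- y) *s w)"
    using assms(1,2) by (simp_all add: point_scale del: vec.scale_minus_left)
  then show False
    using assms(3) eq by metis
qed

lemma vanishes_at_point:
  assumes "f \<in> forms t" "v \<noteq> 0"
  shows "vanishes_at f (point v) \<longleftrightarrow> eval_poly f (($) v) = 0"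
proof
  assume "vanishes_at f (point v)"
  then show "eval_poly f (($) v) = 0"
    using in_line_of_point[OF assms(2)] by (simp add: vanishes_at_def)
next
  assume *: "eval_poly f (($) v) = 0"
  have "($) (c *s v) = (\<lambda>i. c * v $ i)" for c by auto
  then show "vanishes_at f (point v)"
    using * by (auto simp: vanishes_at_def line_of_point[OF assms(2)] eval_form_scale[OF assms(1)])
qed

lemma vanishes_at_mult:
  assumes "f \<in> forms s" "g \<in> forms t"
  shows "vanishes_at (f * g) P \<longleftrightarrow> vanishes_at f P \<or> vanishes_at g P"
proof -
  obtain v where "v \<noteq> 0" "P = point v" by (rule point_exhaust)
  then show ?thesis
    using assms forms_mult[OF assms] by (simp add: vanishes_at_point eval_poly_mult)
qed

lemma not_vanishes_at_one: "\<not> vanishes_at 1 P"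
proof -
  obtain v where "v \<noteq> 0" "P = point v" by (rule point_exhaust)
  then show ?thesis
    by (simp add: vanishes_at_point[OF one_in_forms])
qed

text \<open>
  The generating sets are closed under intersection, as the product of two forms vanishes exactly
  where one of them does. So they form a base.
\<close>

lemma zariski_base:
  assumes "openin zariski U" "P \<in> U"
  shows "\<exists>f t. f \<in> forms t \<and> \<not> vanishes_at f P \<and> {Q. \<not> vanishes_at f Q} \<subseteq> U"
proof -
  have "generate_topology_on {{P. \<not> vanishes_at f P} | f. \<exists>t. f \<in> forms t} U"
    using assms(1) unfolding zariski_def by (rule openin_topology_generated_by)
  then show ?thesis
    using assms(2)
  proof (induction rule: generate_topology_on.induct)
    case (Int a b)
    then obtain f s g t where "f \<in> forms s" "\<not> vanishes_at f P" "{Q. \<not> vanishes_at f Q} \<subseteq> a"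
      "g \<in> forms t" "\<not> vanishes_at g P" "{Q. \<not> vanishes_at g Q} \<subseteq> b" by blast
    then show ?case
      by (intro exI[of _ "f * g"] exI[of _ "s + t"]) (auto simp: forms_mult vanishes_at_mult)
  next
    case (UN K)
    then show ?case by (meson UnionE Union_upper subset_trans)
  qed blast+
qed

lemma openin_zariski_nonvanishing: "f \<in> forms t \<Longrightarrow> openin zariski {P. \<not> vanishes_at f P}"
  unfolding zariski_def by (rule topology_generated_by_Basis) blast

lemma topspace_zariski [simp]: "topspace zariski = UNIV"
  using openin_subset[OF openin_zariski_nonvanishing[OF one_in_forms]] by (auto simp: not_vanishes_at_one)

text \<open>
  Suppose closed sets \<open>A\<close> and \<open>B\<close> cover the closure and neither contains \<open>S\<close>. Then some form vanishes
  on \<open>A\<close> and some form on \<open>B\<close>, neither of them on all of \<open>S\<close>. A point of \<open>S\<close> where both are nonzero lies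
  in neither \<open>A\<close> nor \<open>B\<close>.
\<close>

lemma irreducible_closure:
  assumes "S \<noteq> {}"
    and meet: "\<And>f g s t. \<lbrakk>f \<in> forms s; g \<in> forms t; \<exists>P\<in>S. \<not> vanishes_at f P;
      \<exists>P\<in>S. \<not> vanishes_at g P\<rbrakk> \<Longrightarrow> \<exists>P\<in>S. \<not> vanishes_at f P \<and> \<not> vanishes_at g P"
  shows "irreducible_closed (zariski closure_of S)"
  unfolding irreducible_closed_def
proof (intro conjI allI impI)
  have sub: "S \<subseteq> zariski closure_of S"
    by (rule closure_of_subset) simp
  then show "zariski closure_of S \<noteq> {}"
    using assms(1) by blast
  show "closedin zariski (zariski closure_of S)"
    by (rule closedin_closure_of)
  fix A B assume AB: "closedin zariski A \<and> closedin zariski B \<and> zariski closure_of S = A \<union> B"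
  have nonvanishing: "\<exists>f t. f \<in> forms t \<and> (\<exists>P\<in>S. \<not> vanishes_at f P) \<and> {Q. \<not> vanishes_at f Q} \<subseteq> - C"
    if "closedin zariski C" "\<not> S \<subseteq> C" for C
    using that zariski_base[of "- C"] by (fastforce simp: closedin_def Compl_eq_Diff_UNIV)
  have "S \<subseteq> A \<or> S \<subseteq> B"
  proof (rule ccontr)
    assume "\<not> (S \<subseteq> A \<or> S \<subseteq> B)"
    then obtain f s g t where "f \<in> forms s" "\<exists>P\<in>S. \<not> vanishes_at f P" "{Q. \<not> vanishes_at f Q} \<subseteq> - A"
      "g \<in> forms t" "\<exists>P\<in>S. \<not> vanishes_at g P" "{Q. \<not> vanishes_at g Q} \<subseteq> - B"
      using nonvanishing[of A] nonvanishing[of B] AB by blast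
    then show False
      using meet[of f s g t] AB sub by blast
  qed
  then show "zariski closure_of S = A \<or> zariski closure_of S = B"
    using AB closure_of_minimal by blast
qed

lemma eval_poly_along_line:
  "\<exists>p. \<forall>b. poly p b = eval_poly f (\<lambda>i. u i + b * w i)"
proof
  show "\<forall>b. poly (\<Sum>m\<in>Poly_Mapping.keys f. Polynomial.smult (Poly_Mapping.lookup f m)
      (\<Prod>i\<in>Poly_Mapping.keys m. [:u i, w i:] ^ Poly_Mapping.lookup m i)) b =
    eval_poly f (\<lambda>i. u i + b * w i)"
    by (simp add: poly_sum poly_prod eval_poly_def)
qed

text \<open>
  The minor with columns \<open>k\<close> and \<open>j\<close> of the matrix with rows \<open>p\<close> and the variables. If \<open>p $ k \<noteq> 0\<close>, the
  three minors with \<open>j \<noteq> k\<close> are coordinates for the projection from \<open>p\<close> to a plane.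
\<close>

definition minor_form :: "complex ^ 4 \<Rightarrow> 4 \<Rightarrow> 4 \<Rightarrow> R" where
  "minor_form p k j = const_poly (p $ k) * var_poly j - const_poly (p $ j) * var_poly k"

lemma minor_form_in_forms: "minor_form p k j \<in> forms 1"
  unfolding minor_form_def by (intro forms_diff forms_scale var_poly_in_forms)

lemma eval_minor_form: "eval_poly (minor_form p k j) a = p $ k * a j - p $ j * a k"
  by (simp add: minor_form_def eval_poly_diff eval_poly_mult)

lemma separating_minor_form:
  assumes "v \<noteq> 0" "w \<noteq> 0" "point v \<noteq> point w"
  shows "\<exists>k j. vanishes_at (minor_form v k j) (point v) \<and> \<not> vanishes_at (minor_form v k j) (point w)"
proof -
  obtain k where k: "v $ k \<noteq> 0"
    using assms(1) by (auto simp: Finite_Cartesian_Product.vec_eq_iff)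
  have "\<exists>j. v $ k * w $ j - v $ j * w $ k \<noteq> 0"
  proof (rule ccontr)
    assume *: "\<not> ?thesis"
    \<comment> \<open>If all minors with column \<open>k\<close> vanish, then \<open>v\<close> and \<open>w\<close> are proportional.\<close>
    have "w $ k *s v + (- v $ k) *s w = 0"
    proof (subst Finite_Cartesian_Product.vec_eq_iff, rule allI)
      fix i
      have "v $ k * w $ i - v $ i * w $ k = 0"
        using * by blast
      then show "(w $ k *s v + (- v $ k) *s w) $ i = 0 $ i"
        by (simp add: mult.commute)
    qed
    then show False
      using distinct_points_independent[OF assms, of "w $ k" "- v $ k"] k by simp
  qed
  then show ?thesis
    using assms(1,2) by (auto simp: vanishes_at_point[OF minor_form_in_forms] eval_minor_form)
qed

lemma line_point_nonzero:
  assumes "v \<noteq> 0" "w \<noteq> 0" "point v \<noteq> point w"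
  shows "v + b *s w \<noteq> 0"
  using distinct_points_independent[OF assms, of 1 b] by auto

lemma inj_line_point:
  assumes "v \<noteq> 0" "w \<noteq> 0" "point v \<noteq> point w"
  shows "inj (\<lambda>b. point (v + b *s w))"
proof (rule injI)
  fix b c assume eq: "point (v + b *s w) = point (v + c *s w)"
  have "v + b *s w \<in> line_of (point (v + c *s w))"
    using in_line_of_point[OF line_point_nonzero[OF assms]] eq by metis
  then obtain x where x: "v + b *s w = x *s (v + c *s w)"
    by (auto simp: line_of_point line_point_nonzero[OF assms])
  then have "(1 - x) *s v + (b - x * c) *s w = 0"
    by (simp add: Finite_Cartesian_Product.vec_eq_iff algebra_simps)
  then have "1 - x = 0 \<and> b - x * c = 0"
    by (rule distinct_points_independent[OF assms])
  then show "b = c"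
    by simp
qed

text \<open>
  Along a line a form becomes a polynomial in one parameter. Two nonzero polynomials have only
  finitely many zeros, so an infinite parameter set contains a common nonzero of both.
\<close>

lemma irreducible_closure_of_line_points:
  assumes vw: "v \<noteq> 0" "w \<noteq> 0" "point v \<noteq> point w" and "infinite T"
  shows "irreducible_closed (zariski closure_of ((\<lambda>b. point (v + b *s w)) ` T))"
proof (rule irreducible_closure)
  show "(\<lambda>b. point (v + b *s w)) ` T \<noteq> {}"
    using \<open>infinite T\<close> by auto
  fix f g s t
  assume f: "f \<in> forms s" "\<exists>P\<in>(\<lambda>b. point (v + b *s w)) ` T. \<not> vanishes_at f P"
    and g: "g \<in> forms t" "\<exists>P\<in>(\<lambda>b. point (v + b *s w)) ` T. \<not> vanishes_at g P"
  have coords: "($) (v + b *s w) = (\<lambda>i. v $ i + b * w $ i)" for b by auto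
  obtain p q where p: "\<And>b. poly p b = eval_poly f (\<lambda>i. v $ i + b * w $ i)"
    and q: "\<And>b. poly q b = eval_poly g (\<lambda>i. v $ i + b * w $ i)"
    using eval_poly_along_line by metis
  have vf: "vanishes_at f (point (v + b *s w)) \<longleftrightarrow> poly p b = 0"
    and vg: "vanishes_at g (point (v + b *s w)) \<longleftrightarrow> poly q b = 0" for b
    using vanishes_at_point[OF f(1) line_point_nonzero[OF vw, of b]]
      vanishes_at_point[OF g(1) line_point_nonzero[OF vw, of b]]
    unfolding coords p q by blast+
  have "p * q \<noteq> 0"
    using f(2) g(2) by (auto simp: vf vg)
  then have "finite {b. poly (p * q) b = 0}"
    by (rule poly_roots_finite)
  then obtain b where "b \<in> T" "poly (p * q) b \<noteq> 0"
    using \<open>infinite T\<close> finite_subset[of T "{b. poly (p * q) b = 0}"] by blast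
  then show "\<exists>P\<in>(\<lambda>b. point (v + b *s w)) ` T. \<not> vanishes_at f P \<and> \<not> vanishes_at g P"
    by (intro bexI[of _ "point (v + b *s w)"]) (auto simp: vf vg)
qed

text \<open>
  Infinitely many points of a line in \<open>S\<close> already force dimension at least 1: the closure of one of
  them is properly contained in the closure of all of them, and both are irreducible.
\<close>

lemma codim_closure_of_line_points:
  assumes vw: "v \<noteq> 0" "w \<noteq> 0" "point v \<noteq> point w" and "infinite T"
    and S: "\<And>b. b \<in> T \<Longrightarrow> point (v + b *s w) \<in> S"
  shows "codim (zariski closure_of S) \<noteq> 3"
proof -
  define L where "L = (\<lambda>b. point (v + b *s w)) ` T"
  obtain b c where bc: "b \<in> T" "c \<in> T" "b \<noteq> c"
  proof -
    obtain b where "b \<in> T" using \<open>infinite T\<close> infinite_imp_nonempty by blast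
    moreover from \<open>infinite T\<close> obtain c where "c \<in> T - {b}"
      using infinite_imp_nonempty[of "T - {b}"] by auto
    ultimately show ?thesis using that by blast
  qed
  define P Q where "P = point (v + b *s w)" and "Q = point (v + c *s w)"
  have PQ: "P \<in> L" "Q \<in> L" "P \<noteq> Q"
    using bc injD[OF inj_line_point[OF vw]] by (auto simp: P_def Q_def L_def)
  define Y where "Y i = (if i = 0 then zariski closure_of {P} else zariski closure_of L)" for i :: nat
  have irr: "irreducible_closed (zariski closure_of {P})"
    by (rule irreducible_closure) auto
  obtain k j where kj: "vanishes_at (minor_form (v + b *s w) k j) P"
    "\<not> vanishes_at (minor_form (v + b *s w) k j) Q"
    using separating_minor_form[OF line_point_nonzero[OF vw, of b] line_point_nonzero[OF vw, of c]] PQ(3)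
    unfolding P_def[symmetric] Q_def[symmetric] by blast
  \<comment> \<open>A minor vanishing at \<open>P\<close> but not at \<open>Q\<close> separates the two points.\<close>
  have "Q \<notin> zariski closure_of {P}"
  proof -
    define U where "U = {R. \<not> vanishes_at (minor_form (v + b *s w) k j) R}"
    have "openin zariski U"
      unfolding U_def by (rule openin_zariski_nonvanishing[OF minor_form_in_forms])
    moreover have "Q \<in> U" "P \<notin> U"
      using kj by (simp_all add: U_def)
    ultimately show ?thesis
      by (auto simp: in_closure_of)
  qed
  moreover have "Q \<in> zariski closure_of L"
    using closure_of_subset[of L zariski] PQ by auto
  moreover have "zariski closure_of {P} \<subseteq> zariski closure_of L"
    using PQ by (intro closure_of_mono) auto
  ultimately have strict: "zariski closure_of {P} \<subset> zariski closure_of L" by blast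
  have "L \<subseteq> S"
    using S by (auto simp: L_def)
  then have LS: "zariski closure_of L \<subseteq> zariski closure_of S"
    by (rule closure_of_mono)
  have "ereal (real 1) \<le> zariski_dim (zariski closure_of S)"
    unfolding zariski_dim_def
  proof (rule Sup_upper, intro CollectI exI[of _ 1] conjI refl exI[of _ Y] allI impI)
    show "irreducible_closed (Y i)" for i
      using irr irreducible_closure_of_line_points[OF vw \<open>infinite T\<close>] by (simp add: Y_def L_def)
    show "Y i \<subseteq> zariski closure_of S" for i
      using strict LS by (auto simp: Y_def)
    show "Y i \<subset> Y (Suc i)" if "i < 1" for i
      using strict that by (simp add: Y_def)
  qed
  then show ?thesis
    unfolding codim_def by (cases "zariski_dim (zariski closure_of S)") auto
qed

section \<open>Cones through a finite set of points\<close>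

lemma vanishing_ideal_eval:
  assumes "f \<in> vanishing_ideal Z" "P \<in> Z" "v \<in> line_of P"
  shows "eval_poly f (($) v) = 0"
proof -
  have "vanishing_ideal Z \<subseteq> {f. eval_poly f (($) v) = 0}"
    unfolding vanishing_ideal_def
    by (rule ideal.span_minimal)
      (use assms(2,3) in \<open>auto simp: vanishes_at_def ideal.subspace_def eval_poly_add eval_poly_mult\<close>)
  then show ?thesis using assms(1) by blast
qed

lemma monomial_value_axis:
  fixes m :: "4 \<Rightarrow>\<^sub>0 nat"
  shows "monomial_value (($) (axis k 1)) m = (if Poly_Mapping.keys m \<subseteq> {k} then 1 else 0)"
  by (auto simp: monomial_value_def axis_def in_keys_iff intro!: prod.neutral)

text \<open>
  A form of degree \<open>t\<close> takes at the coordinate point \<open>k\<close> its coefficient of \<open>x\<^sub>k\<^sup>t\<close> as value. If this is 0,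
  every monomial of the form involves another variable.
\<close>

lemma vanishing_ideal_axis:
  "vanishing_ideal {point (axis k 1)} \<subseteq> order_at_least (- {k}) 1"
  unfolding vanishing_ideal_def
proof (rule ideal.span_minimal[OF _ ideal_order_at_least], safe)
  fix f t assume f: "f \<in> forms t" "\<forall>P\<in>{point (axis k 1)}. vanishes_at f P"
  have single: "m = Poly_Mapping.single k t"
    if "m \<in> Poly_Mapping.keys f" "Poly_Mapping.keys m \<subseteq> {k}" for m
  proof (rule poly_mapping_eqI)
    have zero: "Poly_Mapping.lookup m i = 0" if "i \<noteq> k" for i
      using \<open>Poly_Mapping.keys m \<subseteq> {k}\<close> that by (auto simp: in_keys_iff)
    have "t = (\<Sum>i\<in>UNIV. Poly_Mapping.lookup m i)"
      using f(1) that(1) by (simp add: forms_def)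
    also have "\<dots> = (\<Sum>i\<in>{k}. Poly_Mapping.lookup m i)"
      by (rule sum.mono_neutral_right) (auto simp: zero)
    finally show "Poly_Mapping.lookup m i = Poly_Mapping.lookup (Poly_Mapping.single k t) i" for i
      using zero by (simp add: lookup_single when_def)
  qed
  have "axis k 1 \<noteq> (0 :: complex ^ 4)"
    by (simp add: axis_eq_0_iff)
  then have "0 = eval_poly f (($) (axis k 1))"
    using f vanishes_at_point[OF f(1)] by simp
  also have "\<dots> = (\<Sum>m\<in>insert (Poly_Mapping.single k t) (Poly_Mapping.keys f).
      Poly_Mapping.lookup f m * monomial_value (($) (axis k 1)) m)"
    by (rule eval_poly_superset) auto
  also have "\<dots> = (\<Sum>m\<in>{Poly_Mapping.single k t}. Poly_Mapping.lookup f m)"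
    by (rule sum.mono_neutral_cong_right) (auto simp: monomial_value_axis split: if_splits dest: single)
  finally have 0: "Poly_Mapping.lookup f (Poly_Mapping.single k t) = 0" by simp
  show "f \<in> order_at_least (- {k}) 1"
    unfolding order_at_least_def
  proof (intro CollectI ballI)
    fix m assume m: "m \<in> Poly_Mapping.keys f"
    then have "\<not> Poly_Mapping.keys m \<subseteq> {k}"
      using single 0 by (auto simp: in_keys_iff)
    then obtain i where i: "i \<in> - {k}" "Poly_Mapping.lookup m i \<ge> 1"
      by (auto simp: in_keys_iff Suc_le_eq)
    then have "Poly_Mapping.lookup m i \<le> (\<Sum>i\<in>- {k}. Poly_Mapping.lookup m i)"
      by (intro member_le_sum) auto
    then show "1 \<le> (\<Sum>i\<in>- {k}. Poly_Mapping.lookup m i)"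
      using i(2) by linarith
  qed
qed

text \<open>
  A cone with vertex the coordinate point \<open>k\<close> is a form not involving \<open>x\<^sub>k\<close>. If no nonzero
  combination of the monomials in \<open>J\<close> vanishes on \<open>Z\<close>, a cone through \<open>Z\<close> is determined by its
  coefficients outside \<open>J\<close>.
\<close>

lemma weddle_delta_axis_le:
  assumes "J \<subseteq> exponents (- {k}) d"
    and Z: "\<And>c. \<lbrakk>\<And>v. \<lbrakk>v \<noteq> 0; point v \<in> Z\<rbrakk> \<Longrightarrow> (\<Sum>m\<in>J. c m * monomial_value (($) v) m) = 0\<rbrakk>
      \<Longrightarrow> \<forall>m\<in>J. c m = 0"
  shows "weddle_delta d Z (point (axis k 1)) \<le> card (exponents (- {k}) d) - card J"
proof -
  let ?E = "exponents (- {k}) d"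
  let ?V = "vanishing_ideal Z \<inter> ideal_power (vanishing_ideal {point (axis k 1)}) d \<inter> forms d"
  have finE: "finite ?E" by (simp add: exponents_card)
  have "cpoly.dim ?V \<le> card (?E - J)"
  proof (rule dim_le_card_determining_coeffs)
    show "cpoly.subspace ?V"
      by (intro cpoly.subspace_inter subspace_forms ideal_imp_subspace ideal_ideal_power)
        (simp add: vanishing_ideal_def ideal.subspace_span)
    show "finite (?E - J)" using finE by simp
    fix f assume f: "f \<in> ?V" and S: "\<forall>m\<in>?E - J. Poly_Mapping.lookup f m = 0"
    have ord: "f \<in> order_at_least (- {k}) d"
      using f ideal_power_order_at_least[OF vanishing_ideal_axis] by blast
    have "Poly_Mapping.keys f \<subseteq> J"
    proof
      fix m assume m: "m \<in> Poly_Mapping.keys f"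
      \<comment> \<open>The degree outside \<open>k\<close> is at least \<open>d\<close>, and the total degree is \<open>d\<close>; so \<open>x\<^sub>k\<close> does not occur.\<close>
      have "d \<le> (\<Sum>i\<in>- {k}. Poly_Mapping.lookup m i)"
        using ord m by (simp add: order_at_least_def)
      moreover have "(\<Sum>i\<in>- {k}. Poly_Mapping.lookup m i) + Poly_Mapping.lookup m k = d"
        using f m by (auto simp: forms_def Compl_eq_Diff_UNIV sum.remove[of UNIV k])
      ultimately have "Poly_Mapping.lookup m k = 0" "(\<Sum>i\<in>- {k}. Poly_Mapping.lookup m i) = d"
        by linarith+
      then have "m \<in> ?E"
        by (auto simp: exponents_def in_keys_iff)
      then show "m \<in> J"
        using S m by (auto simp: in_keys_iff)
    qed
    moreover have "finite J" using assms(1) finE finite_subset by blast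
    ultimately have "eval_poly f a = (\<Sum>m\<in>J. Poly_Mapping.lookup f m * monomial_value a m)" for a
      by (intro eval_poly_superset)
    moreover have "eval_poly f (($) v) = 0" if "v \<noteq> 0" "point v \<in> Z" for v
      using f that in_line_of_point by (blast intro: vanishing_ideal_eval)
    ultimately have "\<forall>m\<in>J. Poly_Mapping.lookup f m = 0"
      by (intro Z) simp
    then show "f = 0"
      using \<open>Poly_Mapping.keys f \<subseteq> J\<close> by (intro poly_mapping_eqI) (auto simp: in_keys_iff)
  qed
  also have "card (?E - J) = card ?E - card J"
    using assms(1) finE finite_subset by (intro card_Diff_subset) auto
  finally show ?thesis
    unfolding weddle_delta_def .
qed

text \<open>
  The monomial \<open>m\<close> of the plane, pulled back along the projection from \<open>p\<close>.
\<close>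

definition cone_form :: "complex ^ 4 \<Rightarrow> 4 \<Rightarrow> (4 \<Rightarrow>\<^sub>0 nat) \<Rightarrow> R" where
  "cone_form p k m = (\<Prod>i\<in>- {k}. minor_form p k i ^ Poly_Mapping.lookup m i)"

lemma cone_form_in_forms:
  assumes "m \<in> exponents (- {k}) d"
  shows "cone_form p k m \<in> forms d"
proof -
  have "cone_form p k m \<in> forms (\<Sum>i\<in>- {k}. Poly_Mapping.lookup m i * 1)"
    unfolding cone_form_def by (intro forms_prod forms_power minor_form_in_forms) simp
  then show ?thesis
    using assms by (simp add: exponents_def)
qed

lemma cone_form_in_ideal_power:
  assumes "p \<noteq> 0" "m \<in> exponents (- {k}) d"
  shows "cone_form p k m \<in> ideal_power (vanishing_ideal {point p}) d"
proof -
  have "minor_form p k i \<in> vanishing_ideal {point p}" for i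
    unfolding vanishing_ideal_def
    by (rule ideal.span_base)
      (use minor_form_in_forms vanishes_at_point[OF minor_form_in_forms assms(1)] in
        \<open>auto simp: eval_minor_form mult.commute\<close>)
  then have "cone_form p k m \<in> ideal_power (vanishing_ideal {point p}) (\<Sum>i\<in>- {k}. Poly_Mapping.lookup m i)"
    unfolding cone_form_def by (intro prod_powers_in_ideal_power) auto
  then show ?thesis
    using assms(2) by (simp add: exponents_def)
qed

lemma ideal_cong_mult:
  assumes "ideal.subspace I" "a - a' \<in> I" "b - b' \<in> I"
  shows "a * b - a' * b' \<in> I"
proof -
  have "a * b - a' * b' = b * (a - a') + a' * (b - b')"
    by (simp add: algebra_simps)
  then show ?thesis
    using assms ideal.subspace_add ideal.subspace_scale by metis
qed

lemma ideal_cong_power: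
  assumes "ideal.subspace I" "a - a' \<in> I"
  shows "a ^ n - a' ^ n \<in> I"
  using assms by (induction n) (auto intro: ideal_cong_mult ideal.subspace_0)

lemma ideal_cong_prod:
  assumes "ideal.subspace I" "finite A" "\<And>i. i \<in> A \<Longrightarrow> f i - g i \<in> I"
  shows "prod f A - prod g A \<in> I"
  using assms(2,3) by (induction A) (auto intro: ideal_cong_mult ideal.subspace_0 assms(1))

text \<open>
  Setting \<open>x\<^sub>k = 0\<close> turns the minor with columns \<open>k\<close> and \<open>i\<close> into \<open>p\<^sub>k x\<^sub>i\<close>, and hence turns the cone
  forms into nonzero multiples of distinct monomials when \<open>p\<^sub>k \<noteq> 0\<close>. This is how their independence is seen.
\<close>

lemma cone_form_cong:
  assumes "m \<in> exponents (- {k}) d"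
  shows "cone_form p k m - const_poly (p $ k ^ d) * Poly_Mapping.single m 1 \<in> order_at_least {k} 1"
proof -
  have "minor_form p k i - const_poly (p $ k) * var_poly i \<in> order_at_least {k} 1" for i
  proof -
    have "minor_form p k i - const_poly (p $ k) * var_poly i = const_poly (- (p $ i)) * var_poly k"
      by (simp add: minor_form_def const_poly_def single_uminus)
    also have "\<dots> \<in> order_at_least {k} (0 + 1)"
      by (rule order_at_least_mult) (auto simp: order_at_least_def var_poly_def)
    finally show ?thesis by simp
  qed
  then have "cone_form p k m - (\<Prod>i\<in>- {k}. (const_poly (p $ k) * var_poly i) ^ Poly_Mapping.lookup m i)
      \<in> order_at_least {k} 1"
    unfolding cone_form_def
    by (intro ideal_cong_prod ideal_cong_power ideal_order_at_least) auto
  moreover have "(\<Prod>i\<in>- {k}. (const_poly (p $ k) * var_poly i) ^ Poly_Mapping.lookup m i)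
      = const_poly (p $ k ^ d) * Poly_Mapping.single m 1"
  proof -
    have pow: "(const_poly c * var_poly i) ^ e = Poly_Mapping.single (Poly_Mapping.single i e) (c ^ e)"
      for c :: complex and i :: 4 and e
      by (induction e) (simp_all add: const_poly_def var_poly_def mult_single flip: single_add)
    have prod: "(\<Prod>i\<in>A. Poly_Mapping.single (g i) (h i)) = Poly_Mapping.single (\<Sum>i\<in>A. g i) (\<Prod>i\<in>A. h i)"
      if "finite A" for A :: "4 set" and g :: "4 \<Rightarrow> 4 \<Rightarrow>\<^sub>0 nat" and h :: "4 \<Rightarrow> complex"
      using that by induction (simp_all add: mult_single)
    have "m = (\<Sum>i\<in>- {k}. Poly_Mapping.single i (Poly_Mapping.lookup m i))"
      by (rule poly_mapping_eqI)
        (use assms in \<open>auto simp: lookup_sum lookup_single when_def exponents_def in_keys_iff sum.delta\<close>)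
    moreover have "(\<Prod>i\<in>- {k}. (p $ k) ^ Poly_Mapping.lookup m i) = p $ k ^ d"
      using assms by (simp add: exponents_def flip: power_sum)
    ultimately show ?thesis
      by (simp add: pow prod const_poly_mult_single)
  qed
  ultimately show ?thesis by simp
qed

lemma independent_cone_forms:
  assumes "p $ k \<noteq> 0"
  shows "cpoly.independent (cone_form p k ` exponents (- {k}) d)"
    and "inj_on (cone_form p k) (exponents (- {k}) d)"
proof (rule_tac [!] independent_familyI)
  let ?E = "exponents (- {k}) d"
  show fin: "finite ?E" "finite ?E" by (simp_all add: exponents_card)
  fix c :: "(4 \<Rightarrow>\<^sub>0 nat) \<Rightarrow> complex"
  assume 0: "(\<Sum>m\<in>?E. const_poly (c m) * cone_form p k m) = 0"
  let ?g = "\<lambda>m. const_poly (p $ k ^ d) * Poly_Mapping.single m 1"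
  have "(\<Sum>m\<in>?E. const_poly (c m) * (cone_form p k m - ?g m)) \<in> order_at_least {k} 1"
    by (intro ideal.subspace_sum[OF ideal_order_at_least] ideal.subspace_scale[OF ideal_order_at_least]
      cone_form_cong)
  then have ord: "- (\<Sum>m\<in>?E. const_poly (c m) * ?g m) \<in> order_at_least {k} 1"
    using 0 by (simp add: right_diff_distrib sum_subtractf del: cpoly.scale_scale)
  show "\<forall>m\<in>?E. c m = 0"
  proof
    fix n assume n: "n \<in> ?E"
    have "Poly_Mapping.lookup (\<Sum>m\<in>?E. const_poly (c m) * ?g m) n = c n * p $ k ^ d"
      using fin n by (simp add: lookup_sum const_poly_mult_single lookup_single when_def)
    moreover have "Poly_Mapping.lookup (- (\<Sum>m\<in>?E. const_poly (c m) * ?g m)) n = 0"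
      using order_at_leastD[OF ord, of n] n by (auto simp: exponents_def in_keys_iff)
    ultimately show "c n = 0"
      using assms by simp
  qed
  then show "\<forall>m\<in>?E. c m = 0" .
qed

text \<open>
  The vectors \<open>v\<close> and \<open>-b w\<close> differ by the vertex \<open>v + b w\<close>, so the linear forms vanishing at the
  vertex agree on them: the two points have the same projection.
\<close>

lemma eval_cone_form_on_line:
  assumes "m \<in> exponents (- {k}) d"
  shows "eval_poly (cone_form (v + b *s w) k m) (($) v) = (- b) ^ d * eval_poly (cone_form (v + b *s w) k m) (($) w)"
proof -
  have "eval_poly (minor_form (v + b *s w) k i) (($) v) = (- b) * eval_poly (minor_form (v + b *s w) k i) (($) w)" for i
    by (simp add: eval_minor_form algebra_simps)
  then have "eval_poly (cone_form (v + b *s w) k m) (($) v)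
      = (\<Prod>i\<in>- {k}. (- b) ^ Poly_Mapping.lookup m i) * eval_poly (cone_form (v + b *s w) k m) (($) w)"
    by (simp only: cone_form_def eval_poly_prod eval_poly_power power_mult_distrib prod.distrib)
  then show ?thesis
    using assms by (simp add: exponents_def flip: power_sum)
qed

lemma in_vanishing_idealI:
  assumes "f \<in> forms t" "\<And>P. P \<in> Z \<Longrightarrow> \<exists>v. v \<noteq> 0 \<and> P = point v \<and> eval_poly f (($) v) = 0"
  shows "f \<in> vanishing_ideal Z"
  unfolding vanishing_ideal_def
  by (rule ideal.span_base) (use assms vanishes_at_point[OF assms(1)] in blast)

text \<open>
  Among the cones with vertex on the secant line, those vanishing at \<open>v\<close> vanish at \<open>w\<close> as well.
  So it is enough to impose vanishing at the points of \<open>Z\<close> other than \<open>w\<close>, which leaves one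
  more dimension than the number of points predicts.
\<close>

lemma weddle_delta_on_secant:
  assumes vw: "v \<noteq> 0" "w \<noteq> 0" "point v \<noteq> point w" and "finite Z" "point v \<in> Z" "point w \<in> Z"
    and "b \<noteq> 0"
  shows "(d + 2) choose d < weddle_delta d Z (point (v + b *s w)) + card Z"
proof -
  define p where "p = v + b *s w"
  have p: "p \<noteq> 0" unfolding p_def by (rule line_point_nonzero[OF vw])
  then obtain k where k: "p $ k \<noteq> 0" by (auto simp: Finite_Cartesian_Product.vec_eq_iff)
  let ?E = "exponents (- {k}) d"
  let ?B = "cone_form p k ` ?E"
  \<comment> \<open>Representatives of the points, with \<open>v\<close> itself for its point, since the comparison
    with \<open>w\<close> concerns the vector \<open>v\<close>.\<close>
  define \<rho> where "\<rho> P = (if P = point v then v else SOME u. u \<noteq> 0 \<and> P = point u)" for P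
  have \<rho>: "\<rho> P \<noteq> 0 \<and> P = point (\<rho> P)" for P
  proof (cases "P = point v")
    case False
    have "\<exists>u. u \<noteq> 0 \<and> P = point u" by (rule point_exhaust[of P]) blast
    from someI_ex[OF this] show ?thesis using False by (simp add: \<rho>_def)
  qed (use vw in \<open>simp add: \<rho>_def\<close>)
  define A where "A = (\<lambda>P. ($) (\<rho> P)) ` (Z - {point w})"
  have finB: "finite ?B" by (simp add: exponents_card)
  have "finite A" using \<open>finite Z\<close> by (simp add: A_def)
  obtain C where C: "finite C" "cpoly.independent C" "C \<subseteq> cpoly.span ?B"
    "\<forall>f\<in>C. \<forall>a\<in>A. eval_poly f a = 0" "card ?B \<le> card C + card A"
    using independent_vanishing_family[OF \<open>finite A\<close> finB independent_cone_forms(1)[OF k]] by blast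
  have "card (- {k}) = 3"
    by (simp add: Compl_eq_Diff_UNIV card_Diff_subset)
  then have "card ?B = (d + 2) choose d"
    using independent_cone_forms(2)[OF k] by (simp add: card_image exponents_card)
  moreover have "card A < card Z"
  proof -
    have "card A \<le> card (Z - {point w})"
      unfolding A_def using \<open>finite Z\<close> by (intro card_image_le) simp
    also have "\<dots> < card Z"
      using \<open>finite Z\<close> \<open>point w \<in> Z\<close> by (rule card_Diff1_less)
    finally show ?thesis .
  qed
  moreover have "card C \<le> weddle_delta d Z (point p)"
    unfolding weddle_delta_def
  proof (rule card_le_dim_of_forms[OF C(2)])
    let ?S = "{f. eval_poly f (($) v) = (- b) ^ d * eval_poly f (($) w)}"
    have "cpoly.subspace ?S"
      unfolding cpoly.subspace_def by (auto simp: eval_poly_add eval_poly_mult algebra_simps)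
    then have "cpoly.span ?B \<subseteq> ?S"
      by (intro cpoly.span_minimal) (auto simp: p_def eval_cone_form_on_line)
    then have on_line: "eval_poly f (($) v) = (- b) ^ d * eval_poly f (($) w)" if "f \<in> C" for f
      using C(3) that by blast
    have "cpoly.span ?B \<subseteq> forms d"
      by (intro cpoly.span_minimal subspace_forms) (auto intro: cone_form_in_forms)
    then have forms: "C \<subseteq> forms d" using C(3) by blast
    have "cpoly.span ?B \<subseteq> ideal_power (vanishing_ideal {point p}) d"
      by (intro cpoly.span_minimal ideal_imp_subspace ideal_ideal_power)
        (auto intro: cone_form_in_ideal_power[OF p])
    then have power: "C \<subseteq> ideal_power (vanishing_ideal {point p}) d" using C(3) by blast
    have "f \<in> vanishing_ideal Z" if "f \<in> C" for f
    proof (rule in_vanishing_idealI)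
      show "f \<in> forms d" using that forms by blast
      fix P assume "P \<in> Z"
      show "\<exists>u. u \<noteq> 0 \<and> P = point u \<and> eval_poly f (($) u) = 0"
      proof (cases "P = point w")
        case True
        have "($) v \<in> A"
          using assms(3,5) by (auto simp: A_def \<rho>_def intro!: image_eqI[of _ _ "point v"])
        then have "eval_poly f (($) v) = 0" using C(4) that by blast
        then have "eval_poly f (($) w) = 0" using on_line[OF that] \<open>b \<noteq> 0\<close> by simp
        then show ?thesis using True vw by blast
      next
        case False
        then have "eval_poly f (($) (\<rho> P)) = 0"
          using C(4) that \<open>P \<in> Z\<close> by (auto simp: A_def)
        then show ?thesis using \<rho>[of P] by blast
      qed
    qed
    then show "C \<subseteq> vanishing_ideal Z \<inter> ideal_power (vanishing_ideal {point p}) d \<inter> forms d"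
      using forms power by blast
  qed blast
  ultimately show ?thesis
    using C(5) unfolding p_def by linarith
qed

section \<open>The expected codimension\<close>

lemma lookup_single_mult:
  "Poly_Mapping.lookup (Poly_Mapping.single a 1 * f) (a + n) = Poly_Mapping.lookup (f :: 'v cpoly) n"
proof -
  have "Poly_Mapping.single a 1 * f
      = (\<Sum>m\<in>Poly_Mapping.keys f. Poly_Mapping.single (a + m) (Poly_Mapping.lookup f m))"
    using arg_cong[OF sum_single_keys[of f], of "\<lambda>h. Poly_Mapping.single a 1 * h"]
    by (simp add: sum_distrib_left mult_single)
  then show ?thesis
    by (simp add: lookup_sum lookup_single when_def in_keys_iff)
qed

lemma lookup_var_mult:
  "Poly_Mapping.lookup (var_poly k * f) m =
    (if k \<in> Poly_Mapping.keys m then Poly_Mapping.lookup f (m - Poly_Mapping.single k 1) else 0)"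
proof (cases "k \<in> Poly_Mapping.keys m")
  case True
  have "m = Poly_Mapping.single k 1 + (m - Poly_Mapping.single k 1)"
    by (rule poly_mapping_eqI)
      (use True in \<open>auto simp: lookup_add lookup_minus lookup_single when_def in_keys_iff\<close>)
  then show ?thesis
    using True lookup_single_mult[of "Poly_Mapping.single k 1" f "m - Poly_Mapping.single k 1"]
    by (simp add: var_poly_def)
next
  case False
  have "m \<notin> Poly_Mapping.keys (var_poly k * f)"
    using False keys_mult[of "var_poly k" f]
    by (auto simp: var_poly_def in_keys_iff lookup_add)
  then show ?thesis
    using False by (simp add: in_keys_iff)
qed

text \<open>
  The factor \<open>C m\<close> is a multinomial coefficient. Only its positivity and its independence of \<open>v\<close>
  matter, and both follow from Pascal's recursion, without the closed formula.
\<close>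

lemma lookup_dual_form_power:
  "\<exists>C :: (4 \<Rightarrow>\<^sub>0 nat) \<Rightarrow> nat. \<forall>m\<in>exponents UNIV t. C m > 0 \<and>
    (\<forall>v. Poly_Mapping.lookup (dual_form v ^ t) m = of_nat (C m) * monomial_value (($) v) m)"
proof (induction t)
  case 0
  have "m = 0" if "m \<in> exponents UNIV 0" for m :: "4 \<Rightarrow>\<^sub>0 nat"
    using that by (auto simp: exponents_def intro: poly_mapping_eqI)
  note zero = this
  show ?case
  proof (intro exI[of _ "\<lambda>_. 1"] ballI conjI allI)
    fix m :: "4 \<Rightarrow>\<^sub>0 nat" and v assume "m \<in> exponents UNIV 0"
    then have "m = 0" by (rule zero)
    then show "Poly_Mapping.lookup (dual_form v ^ 0) m = of_nat 1 * monomial_value (($) v) m"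
      by simp
  qed simp
next
  case (Suc t)
  then obtain C :: "(4 \<Rightarrow>\<^sub>0 nat) \<Rightarrow> nat" where C: "\<And>m. m \<in> exponents UNIV t \<Longrightarrow> C m > 0"
    "\<And>m v. m \<in> exponents UNIV t \<Longrightarrow>
      Poly_Mapping.lookup (dual_form v ^ t) m = of_nat (C m) * monomial_value (($) v) m"
    by blast
  \<comment> \<open>Multiplication by the linear form raises one exponent of each monomial, so a coefficient
    of the product collects those obtained by lowering one exponent.\<close>
  define C' where "C' m = (\<Sum>k\<in>Poly_Mapping.keys m. C (m - Poly_Mapping.single k 1))" for m
  show ?case
  proof (intro exI[of _ C'] ballI conjI allI)
    fix m :: "4 \<Rightarrow>\<^sub>0 nat" assume m: "m \<in> exponents UNIV (Suc t)"
    have split: "m = Poly_Mapping.single k 1 + (m - Poly_Mapping.single k 1)"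
      if "k \<in> Poly_Mapping.keys m" for k
      by (rule poly_mapping_eqI)
        (use that in \<open>auto simp: lookup_add lookup_minus lookup_single when_def in_keys_iff\<close>)
    have smaller: "m - Poly_Mapping.single k 1 \<in> exponents UNIV t" if "k \<in> Poly_Mapping.keys m" for k
    proof -
      have "Suc t = (\<Sum>i\<in>UNIV. Poly_Mapping.lookup (Poly_Mapping.single k 1 + (m - Poly_Mapping.single k 1)) i)"
        using m split[OF that] by (simp add: exponents_def)
      also have "\<dots> = 1 + (\<Sum>i\<in>UNIV. Poly_Mapping.lookup (m - Poly_Mapping.single k 1) i)"
        unfolding lookup_add sum.distrib by (simp add: lookup_single when_def)
      finally show ?thesis by (simp add: exponents_def)
    qed
    have "Poly_Mapping.keys m \<noteq> {}"
      using m by (auto simp: exponents_def in_keys_iff)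
    then show "C' m > 0"
      unfolding C'_def by (intro sum_pos C(1) smaller) auto
    fix v
    have "dual_form v ^ Suc t = (\<Sum>k\<in>UNIV. const_poly (v $ k) * (var_poly k * dual_form v ^ t))"
      by (simp add: dual_form_def[of v] sum_distrib_right mult.assoc)
    then have "Poly_Mapping.lookup (dual_form v ^ Suc t) m
        = (\<Sum>k\<in>UNIV. v $ k * (if k \<in> Poly_Mapping.keys m
            then Poly_Mapping.lookup (dual_form v ^ t) (m - Poly_Mapping.single k 1) else 0))"
      by (simp only: lookup_sum lookup_const_poly_mult lookup_var_mult)
    also have "\<dots> = (\<Sum>k\<in>Poly_Mapping.keys m.
        v $ k * Poly_Mapping.lookup (dual_form v ^ t) (m - Poly_Mapping.single k 1))"
      by (rule sum.mono_neutral_cong_right) auto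
    also have "\<dots> = (\<Sum>k\<in>Poly_Mapping.keys m.
        of_nat (C (m - Poly_Mapping.single k 1)) * monomial_value (($) v) m)"
    proof (rule sum.cong[OF refl])
      fix k assume k: "k \<in> Poly_Mapping.keys m"
      have "monomial_value (($) v) m = v $ k * monomial_value (($) v) (m - Poly_Mapping.single k 1)"
        using arg_cong[OF split[OF k], of "monomial_value (($) v)"] unfolding monomial_value_add
        by (simp add: monomial_value_def)
      then show "v $ k * Poly_Mapping.lookup (dual_form v ^ t) (m - Poly_Mapping.single k 1) =
          of_nat (C (m - Poly_Mapping.single k 1)) * monomial_value (($) v) m"
        using C(2)[OF smaller[OF k]] by simp
    qed
    also have "\<dots> = of_nat (C' m) * monomial_value (($) v) m"
      by (simp add: C'_def sum_distrib_right)
    finally show "Poly_Mapping.lookup (dual_form v ^ Suc t) m = of_nat (C' m) * monomial_value (($) v) m" .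
  qed
qed

lemma dual_form_in_forms: "dual_form v \<in> forms 1"
  unfolding dual_form_def by (intro forms_sum forms_scale var_poly_in_forms)

lemma dual_form_power_in_forms: "dual_form v ^ d \<in> forms d"
  using forms_power[OF dual_form_in_forms, of v d] by simp

lemma dual_form_scale: "dual_form (c *s v) = const_poly c * dual_form v"
proof -
  have "(const_poly (c * x) :: R) = const_poly c * const_poly x" for x
    by (simp add: const_poly_def mult_single)
  then show ?thesis
    by (simp add: dual_form_def sum_distrib_left mult.assoc del: cpoly.scale_scale)
qed

lemma const_poly_power: "const_poly c ^ n = const_poly (c ^ n)"
  by (induction n) (simp_all add: const_poly_def mult_single)

text \<open>
  Up to terms of degree above \<open>d\<close>, multiplying a form of degree \<open>d\<close> by a polynomial only sees the
  constant term of that polynomial.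
\<close>

lemma ideal_span_of_forms_degree_part:
  assumes "G \<subseteq> forms d"
  shows "ideal.span G \<inter> forms d = cpoly.span G"
proof (rule subset_antisym)
  let ?S = "{a + b | a b. a \<in> cpoly.span G \<and> b \<in> order_at_least UNIV (d + 1)}"
  have G_forms: "cpoly.span G \<subseteq> forms d"
    by (rule cpoly.span_minimal[OF assms subspace_forms])
  have "ideal.subspace ?S"
    unfolding ideal.subspace_def
  proof (intro conjI ballI allI)
    show "0 \<in> ?S"
      using cpoly.span_zero zero_in_order_at_least by force
  next
    fix f g assume "f \<in> ?S" "g \<in> ?S"
    then obtain a b a' b' where ab: "f = a + b" "g = a' + b'" "a \<in> cpoly.span G" "a' \<in> cpoly.span G"
      "b \<in> order_at_least UNIV (d + 1)" "b' \<in> order_at_least UNIV (d + 1)" by blast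
    have "f + g = (a + a') + (b + b')" by (simp add: ab)
    then show "f + g \<in> ?S"
      using ab cpoly.span_add order_at_least_add by blast
  next
    fix c f :: R assume "f \<in> ?S"
    then obtain a b where ab: "f = a + b" "a \<in> cpoly.span G" "b \<in> order_at_least UNIV (d + 1)" by blast
    define c0 :: R where "c0 = const_poly (Poly_Mapping.lookup c 0)"
    have "c - c0 \<in> order_at_least UNIV 1"
      unfolding order_at_least_def
    proof (intro CollectI ballI)
      fix m assume "m \<in> Poly_Mapping.keys (c - c0)"
      then have "m \<noteq> 0"
        by (auto simp: in_keys_iff lookup_minus c0_def const_poly_def)
      then obtain i where "Poly_Mapping.lookup m i \<noteq> 0"
        by (auto simp: poly_mapping_eq_iff fun_eq_iff)
      then have "(\<Sum>i\<in>UNIV. Poly_Mapping.lookup m i) \<noteq> 0"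
        by auto
      then show "1 \<le> (\<Sum>i\<in>UNIV. Poly_Mapping.lookup m i)" by linarith
    qed
    moreover have "a \<in> order_at_least UNIV d"
      using ab(2) G_forms forms_subset_order_at_least by blast
    ultimately have "(c - c0) * a \<in> order_at_least UNIV (d + 1)"
      using order_at_least_mult[of "c - c0" UNIV 1 a d] by simp
    moreover have "c * b \<in> order_at_least UNIV (d + 1)"
      using ideal.subspace_scale[OF ideal_order_at_least ab(3)] .
    ultimately have "(c - c0) * a + c * b \<in> order_at_least UNIV (d + 1)"
      by (rule order_at_least_add)
    moreover have "c0 * a \<in> cpoly.span G"
      unfolding c0_def using ab(2) by (rule cpoly.span_scale)
    moreover have "c * f = c0 * a + ((c - c0) * a + c * b)"
      by (simp add: ab(1) algebra_simps)
    ultimately show "c * f \<in> ?S" by blast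
  qed
  moreover have "G \<subseteq> ?S"
    using cpoly.span_base zero_in_order_at_least by force
  ultimately have sub: "ideal.span G \<subseteq> ?S"
    by (intro ideal.span_minimal)
  show "ideal.span G \<inter> forms d \<subseteq> cpoly.span G"
  proof
    fix f assume f: "f \<in> ideal.span G \<inter> forms d"
    then obtain a b where ab: "f = a + b" "a \<in> cpoly.span G" "b \<in> order_at_least UNIV (d + 1)"
      using sub by blast
    then have "b \<in> forms d"
      using f G_forms forms_diff[of f d a] by auto
    then have "b = 0"
      using form_of_higher_order_eq_0 ab(3) by simp
    then show "f \<in> cpoly.span G" using ab by simp
  qed
  have "cpoly.span G \<subseteq> ideal.span G"
    by (rule cpoly.span_minimal[OF ideal.span_superset ideal_imp_subspace[OF ideal.subspace_span]])
  then show "cpoly.span G \<subseteq> ideal.span G \<inter> forms d"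
    using G_forms by blast
qed

text \<open>
  A relation between the powers of the dual forms is, coefficient by coefficient, a relation between
  the rows of values of the monomials at the points.
\<close>

lemma dim_power_ideal:
  assumes "finite Z" and \<rho>: "\<And>P. P \<in> Z \<Longrightarrow> \<rho> P \<noteq> 0 \<and> P = point (\<rho> P)" and "J \<subseteq> exponents UNIV d"
    and ind: "\<And>c. \<lbrakk>\<And>m. m \<in> J \<Longrightarrow> (\<Sum>P\<in>Z. c P * monomial_value (($) (\<rho> P)) m) = 0\<rbrakk>
      \<Longrightarrow> \<forall>P\<in>Z. c P = 0"
  shows "cpoly.dim (power_ideal d Z \<inter> forms d) = card Z"
proof -
  let ?G = "{dual_form v ^ d | v P. P \<in> Z \<and> v \<in> line_of P \<and> v \<noteq> 0}"
  let ?L = "\<lambda>P. dual_form (\<rho> P) ^ d"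
  have "power_ideal d Z \<inter> forms d = cpoly.span ?G"
    unfolding power_ideal_def
    by (rule ideal_span_of_forms_degree_part) (auto intro: dual_form_power_in_forms)
  also have "\<dots> = cpoly.span (?L ` Z)"
    unfolding cpoly.span_eq
  proof
    \<comment> \<open>Another coordinate vector of the same point only changes the power by a scalar.\<close>
    show "?G \<subseteq> cpoly.span (?L ` Z)"
    proof clarify
      fix v P assume P: "P \<in> Z" "v \<in> line_of P"
      then have "v \<in> range (\<lambda>c. c *s \<rho> P)"
        using \<rho>[OF P(1)] line_of_point by metis
      then obtain c where "v = c *s \<rho> P" by blast
      then have "dual_form v ^ d = const_poly (c ^ d) * ?L P"
        by (simp add: dual_form_scale power_mult_distrib const_poly_power)
      then show "dual_form v ^ d \<in> cpoly.span (?L ` Z)"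
        using P(1) by (auto intro: cpoly.span_scale cpoly.span_base)
    qed
    show "?L ` Z \<subseteq> cpoly.span ?G"
      using \<rho> in_line_of_point by (intro image_subsetI cpoly.span_base CollectI) metis
  qed
  finally have span: "power_ideal d Z \<inter> forms d = cpoly.span (?L ` Z)" .
  obtain C :: "(4 \<Rightarrow>\<^sub>0 nat) \<Rightarrow> nat" where C: "\<And>m. m \<in> exponents UNIV d \<Longrightarrow> C m > 0"
    "\<And>m v. m \<in> exponents UNIV d \<Longrightarrow>
      Poly_Mapping.lookup (dual_form v ^ d) m = of_nat (C m) * monomial_value (($) v) m"
    using lookup_dual_form_power[of d] by blast
  have zero: "\<forall>P\<in>Z. c P = 0" if 0: "(\<Sum>P\<in>Z. const_poly (c P) * ?L P) = 0" for c
  proof (rule ind)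
    fix m assume "m \<in> J"
    then have m: "m \<in> exponents UNIV d" using assms(3) by blast
    have "0 = Poly_Mapping.lookup (\<Sum>P\<in>Z. const_poly (c P) * ?L P) m"
      by (simp add: 0)
    also have "\<dots> = (\<Sum>P\<in>Z. c P * (of_nat (C m) * monomial_value (($) (\<rho> P)) m))"
      by (simp add: lookup_sum lookup_const_poly_mult C(2)[OF m])
    also have "\<dots> = of_nat (C m) * (\<Sum>P\<in>Z. c P * monomial_value (($) (\<rho> P)) m)"
      by (simp add: sum_distrib_left mult.left_commute)
    finally show "(\<Sum>P\<in>Z. c P * monomial_value (($) (\<rho> P)) m) = 0"
      using C(1)[OF m] by simp
  qed
  have "cpoly.independent (?L ` Z)" "inj_on ?L Z"
    by (rule independent_familyI[OF \<open>finite Z\<close>], erule zero)+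
  then show ?thesis
    unfolding span by (simp add: cpoly.dim_eq_card_independent card_image)
qed

lemma dim_power_ideal_below:
  assumes "t < d"
  shows "cpoly.dim (power_ideal d Z \<inter> forms t) = 0"
proof -
  have "power_ideal d Z \<subseteq> order_at_least UNIV d"
    unfolding power_ideal_def
    using dual_form_power_in_forms forms_subset_order_at_least
    by (intro ideal.span_minimal ideal_order_at_least) blast
  then have "power_ideal d Z \<inter> forms t \<subseteq> cpoly.span {}"
    using form_of_higher_order_eq_0[OF _ _ assms] by auto
  then show ?thesis
    using cpoly.dim_le_card[of _ "{}"] by simp
qed

text \<open>
  By Pascal's rule the spaces have dimensions \<open>p = (d + 2) choose 3\<close> and
  \<open>p + ((d + 2) choose 2) - r = p + 2\<close>, so the expected codimension is \<open>1 * 3\<close>.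
\<close>

lemma weddle_expected_codim_eq_3:
  assumes "d \<ge> 2" "card Z = ((d + 2) choose 2) - 2" "cpoly.dim (power_ideal d Z \<inter> forms d) = card Z"
  shows "weddle_expected_codim d Z = 3"
proof -
  define p where "p = (d + 2) choose 3"
  have p: "dim_quotient_piece (power_ideal d Z) (d - 1) = p"
    using assms(1) binomial_symmetric[of 3 "d + 2"]
    by (simp add: dim_quotient_piece_def dim_forms dim_power_ideal_below p_def)
  have "(d + 3) choose d = (d + 3) choose 3"
    using binomial_symmetric[of 3 "d + 3"] by simp
  also have "\<dots> = p + ((d + 2) choose 2)"
    by (simp add: p_def eval_nat_numeral)
  finally have "(d + 3) choose d = p + ((d + 2) choose 2)" .
  moreover have "2 \<le> (d + 2) choose 2"
  proof -
    obtain e where "d = e + 2"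
      using assms(1) le_Suc_ex[of 2 d] by auto
    then show ?thesis by (simp add: eval_nat_numeral)
  qed
  ultimately have q: "dim_quotient_piece (power_ideal d Z) d = p + 2"
    by (simp add: dim_quotient_piece_def dim_forms assms(2,3))
  have "p > 0"
    using assms(1) by (simp add: p_def zero_less_binomial_iff)
  then show ?thesis
    unfolding weddle_expected_codim_def p q expected_codim_minors_def Let_def by simp
qed

section \<open>The interpolation determinant\<close>

lemma det_nonzero_iff:
  fixes a :: "nat \<Rightarrow> nat \<Rightarrow> complex"
  shows "Determinant.det (Matrix.mat r r (\<lambda>(i, j). a i j)) \<noteq> 0 \<longleftrightarrow>
    (\<forall>c. (\<forall>i<r. (\<Sum>j<r. a i j * c j) = 0) \<longrightarrow> (\<forall>j<r. c j = 0))"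
proof -
  let ?A = "Matrix.mat r r (\<lambda>(i, j). a i j)"
  have A: "?A \<in> carrier_mat r r" by simp
  have entry: "vec_index (?A *\<^sub>v x) i = (\<Sum>j<r. a i j * vec_index x j)"
    if "x \<in> carrier_vec r" "i < r" for x i
    using that by (simp add: scalar_prod_def lessThan_atLeast0)
  have kernel: "?A *\<^sub>v x = 0\<^sub>v r \<longleftrightarrow> (\<forall>i<r. (\<Sum>j<r. a i j * vec_index x j) = 0)"
    if x: "x \<in> carrier_vec r" for x
  proof
    assume 0: "?A *\<^sub>v x = 0\<^sub>v r"
    show "\<forall>i<r. (\<Sum>j<r. a i j * vec_index x j) = 0"
      using entry[OF x] unfolding 0 by simp
  next
    assume 0: "\<forall>i<r. (\<Sum>j<r. a i j * vec_index x j) = 0"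
    show "?A *\<^sub>v x = 0\<^sub>v r"
    proof (rule Matrix.eq_vecI)
      fix i assume "i < dim_vec (0\<^sub>v r :: complex Matrix.vec)"
      then have "i < r" by simp
      then show "vec_index (?A *\<^sub>v x) i = vec_index (0\<^sub>v r) i"
        unfolding entry[OF x \<open>i < r\<close>] using 0 by simp
    qed simp
  qed
  have zero: "x = 0\<^sub>v r \<longleftrightarrow> (\<forall>j<r. vec_index x j = 0)"
    if "x \<in> carrier_vec r" for x :: "complex Matrix.vec"
    using that by (auto intro: Matrix.eq_vecI)
  show ?thesis
  proof
    assume "Determinant.det ?A \<noteq> 0"
    then have *: "\<And>x. x \<in> carrier_vec r \<Longrightarrow> ?A *\<^sub>v x = 0\<^sub>v r \<Longrightarrow> x = 0\<^sub>v r"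
      using det_0_iff_vec_prod_zero_field[OF A] by blast
    show "\<forall>c. (\<forall>i<r. (\<Sum>j<r. a i j * c j) = 0) \<longrightarrow> (\<forall>j<r. c j = 0)"
    proof (intro allI impI)
      fix c j assume c: "\<forall>i<r. (\<Sum>j<r. a i j * c j) = 0" and "j < r"
      let ?x = "Matrix.vec r c"
      have x: "?x \<in> carrier_vec r" by simp
      have "?A *\<^sub>v ?x = 0\<^sub>v r"
        unfolding kernel[OF x] using c by simp
      then have "\<forall>j<r. vec_index ?x j = 0"
        using *[OF x] zero[OF x] by blast
      then show "c j = 0"
        using \<open>j < r\<close> by simp
    qed
  next
    assume *: "\<forall>c. (\<forall>i<r. (\<Sum>j<r. a i j * c j) = 0) \<longrightarrow> (\<forall>j<r. c j = 0)"
    have "x = 0\<^sub>v r" if "x \<in> carrier_vec r" "?A *\<^sub>v x = 0\<^sub>v r" for x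
      using *[rule_format, of "vec_index x"] that kernel zero by blast
    then show "Determinant.det ?A \<noteq> 0"
      using det_0_iff_vec_prod_zero_field[OF A] by blast
  qed
qed

lemma det_swap:
  "Determinant.det (Matrix.mat r r (\<lambda>(i, j). a j i)) = Determinant.det (Matrix.mat r r (\<lambda>(i, j). a i j))"
proof -
  have "transpose_mat (Matrix.mat r r (\<lambda>(i, j). a i j)) = Matrix.mat r r (\<lambda>(i, j). a j i)"
    by (rule eq_matI) auto
  then show ?thesis
    using det_transpose[of "Matrix.mat r r (\<lambda>(i, j). a i j)" r] by simp
qed

text \<open>
  The monomial \<open>m\<close> in the coordinates of the \<open>i\<close>-th point of a tuple.
\<close>

definition in_point :: "nat \<Rightarrow> (4 \<Rightarrow>\<^sub>0 nat) \<Rightarrow> (nat \<times> 4 \<Rightarrow>\<^sub>0 nat)" where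
  "in_point i m = (\<Sum>k\<in>UNIV. Poly_Mapping.single (i, k) (Poly_Mapping.lookup m k))"

lemma lookup_in_point:
  "Poly_Mapping.lookup (in_point i m) (j, k) = (if j = i then Poly_Mapping.lookup m k else 0)"
  by (cases "j = i") (auto simp: in_point_def lookup_sum lookup_single when_def)

lemma monomial_value_in_point:
  "monomial_value a (in_point i m) = monomial_value (\<lambda>k. a (i, k)) m"
proof -
  have "Poly_Mapping.keys (in_point i m) \<subseteq> Pair i ` UNIV"
    by (auto simp: in_keys_iff lookup_in_point split: if_splits)
  then have "monomial_value a (in_point i m)
      = (\<Prod>x\<in>Pair i ` UNIV. a x ^ Poly_Mapping.lookup (in_point i m) x)"
    by (intro monomial_value_superset) auto
  also have "\<dots> = (\<Prod>k\<in>UNIV. a (i, k) ^ Poly_Mapping.lookup m k)"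
    by (subst prod.reindex) (auto simp: inj_on_def lookup_in_point)
  also have "\<dots> = monomial_value (\<lambda>k. a (i, k)) m"
    by (rule monomial_value_superset[symmetric]) auto
  finally show ?thesis .
qed

definition interpolation_det :: "nat \<Rightarrow> (nat \<Rightarrow> 4 \<Rightarrow>\<^sub>0 nat) \<Rightarrow> (nat \<times> 4) cpoly" where
  "interpolation_det r \<mu> =
     Determinant.det (Matrix.mat r r (\<lambda>(i, j). Poly_Mapping.single (in_point i (\<mu> j)) 1))"

lemma eval_interpolation_det:
  "eval_poly (interpolation_det r \<mu>) a
    = Determinant.det (Matrix.mat r r (\<lambda>(i, j). monomial_value (\<lambda>k. a (i, k)) (\<mu> j)))"
proof -
  interpret hom: comm_ring_hom "\<lambda>f. eval_poly f a"
    by unfold_locales (simp_all add: eval_poly_add eval_poly_mult)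
  have "map_mat (\<lambda>f. eval_poly f a)
      (Matrix.mat r r (\<lambda>(i, j). Poly_Mapping.single (in_point i (\<mu> j)) (1::complex)))
    = Matrix.mat r r (\<lambda>(i, j). monomial_value (\<lambda>k. a (i, k)) (\<mu> j))"
    by (rule eq_matI) (auto simp: eval_poly_single monomial_value_in_point)
  then show ?thesis
    unfolding interpolation_det_def by (metis hom.hom_det)
qed

text \<open>
  Each term of the Leibniz expansion takes exactly one factor from each row, and row \<open>i\<close> consists of
  monomials of degree \<open>d\<close> in the coordinates of the \<open>i\<close>-th point.
\<close>

lemma multihomogeneous_interpolation_det:
  assumes "\<And>j. j < r \<Longrightarrow> \<mu> j \<in> exponents UNIV d"
  shows "multihomogeneous r (interpolation_det r \<mu>)"
  unfolding multihomogeneous_def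
proof (intro exI[of _ "\<lambda>_. d"] ballI)
  fix m assume "m \<in> Poly_Mapping.keys (interpolation_det r \<mu>)"
  moreover have "interpolation_det r \<mu> = (\<Sum>p\<in>{p. p permutes {0..<r}}.
      signof p * (\<Prod>i = 0..<r. Poly_Mapping.single (in_point i (\<mu> (p i))) 1))"
    unfolding interpolation_det_def
    by (subst det_def'[of _ r]) (auto intro!: sum.cong prod.cong arg_cong2[where f = times]
      dest: permutes_nat_less)
  ultimately obtain p where p: "p permutes {0..<r}"
    "m \<in> Poly_Mapping.keys (signof p * (\<Prod>i = 0..<r. Poly_Mapping.single (in_point i (\<mu> (p i))) (1::complex)))"
    using keys_sum by fastforce
  have prod: "(\<Prod>i\<in>A. Poly_Mapping.single (g i) (1::complex)) = Poly_Mapping.single (\<Sum>i\<in>A. g i) 1"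
    if "finite A" for A :: "nat set" and g :: "nat \<Rightarrow> (nat \<times> 4 \<Rightarrow>\<^sub>0 nat)"
    using that by induction (simp_all add: mult_single)
  have m: "m = (\<Sum>i<r. in_point i (\<mu> (p i)))"
    using p(2) by (auto simp: prod sign_def lessThan_atLeast0 split: if_splits)
  have look: "Poly_Mapping.lookup m (i, k) = (if i < r then Poly_Mapping.lookup (\<mu> (p i)) k else 0)" for i k
    unfolding m by (simp add: lookup_sum lookup_in_point)
  show "(\<forall>i<r. (\<Sum>k\<in>UNIV. Poly_Mapping.lookup m (i, k)) = d) \<and> (\<forall>i\<ge>r. \<forall>k. Poly_Mapping.lookup m (i, k) = 0)"
  proof (intro conjI allI impI)
    fix i assume "i < r"
    then have "p i < r"
      using permutes_in_image[OF p(1), of i] by simp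
    then show "(\<Sum>k\<in>UNIV. Poly_Mapping.lookup m (i, k)) = d"
      using assms[of "p i"] \<open>i < r\<close> by (simp add: look exponents_def)
  qed (simp add: look)
qed

section \<open>Points with nonzero interpolation determinant\<close>

text \<open>
  The point \<open>[1 : t : t\<^bsup>d+1\<^esup> : 0]\<close> for \<open>t = 2\<^sup>i\<close>. A monomial with exponents \<open>e\<^sub>1, e\<^sub>2, e\<^sub>3\<close> takes the value
  \<open>w\<^sup>i\<close> there, with \<open>w = 2\<^sup>e\<close> for \<open>e = e\<^sub>2 + (d + 1) e\<^sub>3\<close>.
\<close>

definition moment_point :: "nat \<Rightarrow> nat \<Rightarrow> complex ^ 4" where
  "moment_point d i = (\<chi> k. if k = 1 then 1 else if k = 2 then 2 ^ i else if k = 3 then 2 ^ ((d + 1) * i) else 0)"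

lemma moment_point_nonzero: "moment_point d i \<noteq> 0"
proof
  assume "moment_point d i = 0"
  then have "moment_point d i $ 1 = 0" by simp
  then show False by (simp add: moment_point_def)
qed

lemma compl_4: "- {4 :: 4} = {1, 2, 3}"
  using exhaust_4 by auto

lemma monomial_value_moment_point:
  assumes "m \<in> exponents (- {4}) d"
  shows "monomial_value (($) (moment_point d i)) m
    = (2 ^ (Poly_Mapping.lookup m 2 + (d + 1) * Poly_Mapping.lookup m 3)) ^ i"
proof -
  have "monomial_value (($) (moment_point d i)) m
      = (\<Prod>k\<in>{1, 2, 3}. moment_point d i $ k ^ Poly_Mapping.lookup m k)"
    by (rule monomial_value_superset) (use assms in \<open>auto simp: exponents_def compl_4\<close>)
  also have "\<dots> = 2 ^ (i * Poly_Mapping.lookup m 2) * 2 ^ ((d + 1) * i * Poly_Mapping.lookup m 3)"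
    by (simp add: moment_point_def power_mult)
  also have "\<dots> = 2 ^ ((Poly_Mapping.lookup m 2 + (d + 1) * Poly_Mapping.lookup m 3) * i)"
    unfolding power_add[symmetric] by (rule arg_cong[of _ _ "power 2"]) (simp add: algebra_simps)
  also have "\<dots> = (2 ^ (Poly_Mapping.lookup m 2 + (d + 1) * Poly_Mapping.lookup m 3)) ^ i"
    by (rule power_mult)
  finally show ?thesis .
qed

text \<open>
  The second and third exponents are digits in base \<open>d + 1\<close>, and the first one is what is missing to
  the degree \<open>d\<close>.
\<close>

lemma inj_on_moment_exponent:
  "inj_on (\<lambda>m. Poly_Mapping.lookup m 2 + (d + 1) * Poly_Mapping.lookup m 3) (exponents (- {4 :: 4}) d)"
proof (rule inj_onI, rule poly_mapping_eqI)
  fix m n :: "4 \<Rightarrow>\<^sub>0 nat" and k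
  assume m: "m \<in> exponents (- {4}) d" and n: "n \<in> exponents (- {4}) d"
    and eq: "Poly_Mapping.lookup m 2 + (d + 1) * Poly_Mapping.lookup m 3
      = Poly_Mapping.lookup n 2 + (d + 1) * Poly_Mapping.lookup n 3"
  have sums: "Poly_Mapping.lookup m 1 + Poly_Mapping.lookup m 2 + Poly_Mapping.lookup m 3 = d"
    "Poly_Mapping.lookup n 1 + Poly_Mapping.lookup n 2 + Poly_Mapping.lookup n 3 = d"
    using m n by (auto simp: exponents_def compl_4)
  have dm: "(x + (d + 1) * y) mod (d + 1) = x" "(x + (d + 1) * y) div (d + 1) = y" if "x \<le> d" for x y
    using that by (simp_all add: mod_less div_less del: mult_Suc)
  have le: "Poly_Mapping.lookup m 2 \<le> d" "Poly_Mapping.lookup n 2 \<le> d"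
    using sums by linarith+
  have "Poly_Mapping.lookup m 2 = Poly_Mapping.lookup n 2" "Poly_Mapping.lookup m 3 = Poly_Mapping.lookup n 3"
    using dm[OF le(1), of "Poly_Mapping.lookup m 3"] dm[OF le(2), of "Poly_Mapping.lookup n 3"] eq
    by simp_all
  moreover from this have "Poly_Mapping.lookup m 1 = Poly_Mapping.lookup n 1"
    using sums by linarith
  moreover have "Poly_Mapping.lookup m 4 = 0" "Poly_Mapping.lookup n 4 = 0"
    using m n by (auto simp: exponents_def compl_4 in_keys_iff)
  ultimately show "Poly_Mapping.lookup m k = Poly_Mapping.lookup n k"
    using exhaust_4[of k] by auto
qed

text \<open>
  The matrix is the Vandermonde matrix of the distinct numbers \<open>w\<close>. A vector in its left kernel consists of the coefficients
  of a polynomial of degree less than \<open>r\<close> with \<open>r\<close> zeros.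
\<close>

lemma moment_points_det_nonzero:
  assumes \<mu>: "bij_betw \<mu> {..<r} J" and "J \<subseteq> exponents (- {4}) d"
  shows "Determinant.det (Matrix.mat r r (\<lambda>(i, j). monomial_value (($) (moment_point d i)) (\<mu> j))) \<noteq> 0"
proof -
  define w :: "nat \<Rightarrow> complex"
    where "w j = 2 ^ (Poly_Mapping.lookup (\<mu> j) 2 + (d + 1) * Poly_Mapping.lookup (\<mu> j) 3)" for j
  have \<mu>E: "\<mu> j \<in> exponents (- {4}) d" if "j < r" for j
    using \<mu> assms(2) that by (auto simp: bij_betw_def)
  have val: "monomial_value (($) (moment_point d i)) (\<mu> j) = w j ^ i" if "j < r" for i j
    using monomial_value_moment_point[OF \<mu>E[OF that]] by (simp add: w_def)
  have "inj_on w {..<r}"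
  proof (rule inj_onI)
    fix i j assume ij: "i \<in> {..<r}" "j \<in> {..<r}" "w i = w j"
    have "(of_nat (2 ^ x) :: complex) = of_nat (2 ^ y) \<Longrightarrow> x = y" for x y :: nat
      unfolding of_nat_eq_iff by simp
    then have "Poly_Mapping.lookup (\<mu> i) 2 + (d + 1) * Poly_Mapping.lookup (\<mu> i) 3
        = Poly_Mapping.lookup (\<mu> j) 2 + (d + 1) * Poly_Mapping.lookup (\<mu> j) 3"
      using ij(3) unfolding w_def by simp
    then have "\<mu> i = \<mu> j"
      using inj_onD[OF inj_on_moment_exponent] \<mu>E ij by blast
    then show "i = j"
      using \<mu> ij by (auto simp: bij_betw_def inj_on_def)
  qed
  have "Determinant.det (Matrix.mat r r (\<lambda>(j, i). w j ^ i)) \<noteq> 0"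
    unfolding det_nonzero_iff
  proof (intro allI impI)
    fix c i assume c: "\<forall>j<r. (\<Sum>i<r. w j ^ i * c i) = 0" and "i < r"
    define q where "q = (\<Sum>i<r. Polynomial.monom (c i) i)"
    have "q = 0"
    proof (rule ccontr)
      assume "q \<noteq> 0"
      have "poly q (w j) = 0" if "j < r" for j
        using c that by (simp add: q_def poly_sum poly_monom mult.commute)
      then have "w ` {..<r} \<subseteq> {x. poly q x = 0}" by auto
      then have "r \<le> card {x. poly q x = 0}"
        using card_mono[OF poly_roots_finite[OF \<open>q \<noteq> 0\<close>]] \<open>inj_on w {..<r}\<close> by (metis card_image card_lessThan)
      also have "\<dots> \<le> Polynomial.degree q"
        using card_poly_roots_bound[OF \<open>q \<noteq> 0\<close>] .
      also have "\<dots> < r"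
      proof -
        have "Polynomial.degree q \<le> r - 1"
          unfolding q_def by (intro degree_sum_le order_trans[OF degree_monom_le]) auto
        then show ?thesis using \<open>i < r\<close> by linarith
      qed
      finally show False by simp
    qed
    then have "0 = Polynomial.coeff q i" by simp
    also have "\<dots> = c i"
      using \<open>i < r\<close> by (simp add: q_def coeff_sum)
    finally show "c i = 0" by simp
  qed
  also have "Determinant.det (Matrix.mat r r (\<lambda>(j, i). w j ^ i))
      = Determinant.det (Matrix.mat r r (\<lambda>(i, j). w j ^ i))"
    using det_swap[of r "\<lambda>i j. w j ^ i"] by simp
  also have "Matrix.mat r r (\<lambda>(i, j). w j ^ i)
      = Matrix.mat r r (\<lambda>(i, j). monomial_value (($) (moment_point d i)) (\<mu> j))"
    by (rule eq_matI) (simp_all add: val)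
  finally show ?thesis .
qed

section \<open>The Weddle locus of a general set\<close>

text \<open>
  All consequences of the nonvanishing of the determinant for one tuple of points. Independent rows give
  distinctness and the expected codimension; independent columns bound the minimum of \<open>\<delta>\<close>.
\<close>

lemma general_points:
  fixes v :: "nat \<Rightarrow> complex ^ 4" and ps :: "P3 list"
  assumes "d \<ge> 2" and r: "r = ((d + 2) choose 2) - 2"
    and \<mu>: "bij_betw \<mu> {..<r} J" and J: "J \<subseteq> exponents (- {4}) d"
    and "length ps = r" and v: "\<And>i. i < r \<Longrightarrow> v i \<in> line_of (ps ! i)"
    and det: "Determinant.det (Matrix.mat r r (\<lambda>(i, j). monomial_value (($) (v i)) (\<mu> j))) \<noteq> 0"
  shows "distinct ps \<and> weddle_expected_codim d (set ps) = 3 \<and> codim (weddle_locus d (set ps)) \<noteq> 3"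
proof -
  define a where "a i j = monomial_value (($) (v i)) (\<mu> j)" for i j
  have cols: "\<forall>j<r. c j = 0" if "\<forall>i<r. (\<Sum>j<r. a i j * c j) = 0" for c
    using det that unfolding a_def[symmetric] det_nonzero_iff by blast
  have rows: "\<forall>i<r. c i = 0" if "\<forall>j<r. (\<Sum>i<r. a i j * c i) = 0" for c
    using det that unfolding a_def[symmetric] det_swap[of r a, symmetric] det_nonzero_iff[of r "\<lambda>i j. a j i"]
    by blast
  have \<mu>E: "\<mu> j \<in> exponents (- {4}) d" if "j < r" for j
    using \<mu> J that by (auto simp: bij_betw_def)
  have deg: "(\<Sum>k\<in>UNIV. Poly_Mapping.lookup (\<mu> j) k) = d" if "j < r" for j
    using sum_lookup_exponents[OF \<mu>E[OF that]] .
  have scale: "monomial_value (($) (x *s u)) (\<mu> j) = x ^ d * monomial_value (($) u) (\<mu> j)"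
    if "j < r" for x u j
  proof -
    have "($) (x *s u) = (\<lambda>k. x * u $ k)" by auto
    then show ?thesis
      using monomial_value_scale[of x "($) u" "\<mu> j"] deg[OF that] by simp
  qed
  have row_nonzero: "\<exists>j<r. a i j \<noteq> 0" if "i < r" for i
  proof (rule ccontr)
    assume "\<not> (\<exists>j<r. a i j \<noteq> 0)"
    then have "\<forall>j<r. (\<Sum>k<r. a k j * (if k = i then 1 else 0)) = 0"
      using that by (auto intro!: sum.neutral)
    from rows[OF this] show False using that by auto
  qed
  have v0: "v i \<noteq> 0" if "i < r" for i
  proof
    assume "v i = 0"
    then have "a i j = 0" if "j < r" for j
      using scale[OF that, of 0 "v i"] \<open>d \<ge> 2\<close> by (simp add: a_def power_0_left)
    then show False using row_nonzero[OF that] by blast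
  qed
  have pt: "ps ! i = point (v i)" if "i < r" for i
    using point_eqI[OF v0[OF that] v[OF that]] .
  have distinct: "distinct ps"
    unfolding distinct_conv_nth \<open>length ps = r\<close>
  proof (intro allI impI notI)
    fix i k assume ik: "i < r" "k < r" "i \<noteq> k" "ps ! i = ps ! k"
    have "v i \<in> line_of (point (v k))"
      using v[OF ik(1)] ik(4) pt[OF ik(2)] by simp
    then obtain x where x: "v i = x *s v k"
      using line_of_point[OF v0[OF ik(2)]] by auto
    \<comment> \<open>Proportional coordinate vectors give a relation between two rows.\<close>
    define c where "c l = (if l = i then 1 else if l = k then - (x ^ d) else 0)" for l
    have "(\<Sum>l<r. a l j * c l) = 0" if "j < r" for j
    proof -
      have "(\<Sum>l<r. a l j * c l) = (\<Sum>l\<in>{i, k}. a l j * c l)"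
        by (rule sum.mono_neutral_right) (use ik in \<open>auto simp: c_def\<close>)
      also have "\<dots> = a i j - x ^ d * a k j"
        using ik(3) by (simp add: c_def)
      also have "\<dots> = 0"
        using scale[OF that, of x "v k"] by (simp add: a_def x)
      finally show ?thesis .
    qed
    then show False
      using rows[of c] ik(1) by (auto simp: c_def)
  qed
  let ?Z = "set ps"
  have Z: "bij_betw ((!) ps) {..<r} ?Z"
    using bij_betw_nth[OF distinct] \<open>length ps = r\<close> by simp
  have cardZ: "card ?Z = r"
    using distinct_card[OF distinct] \<open>length ps = r\<close> by simp
  have inZ: "point (v i) \<in> ?Z" if "i < r" for i
    using pt[OF that] nth_mem[of i ps] that \<open>length ps = r\<close> by simp

  define \<rho> where "\<rho> P = v (inv_into {..<r} ((!) ps) P)" for P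
  have \<rho>: "\<rho> (ps ! i) = v i" if "i < r" for i
    using bij_betw_inv_into_left[OF Z] that by (simp add: \<rho>_def)
  have "cpoly.dim (power_ideal d ?Z \<inter> forms d) = card ?Z"
  proof (rule dim_power_ideal)
    show "finite ?Z" by simp
    show "J \<subseteq> exponents UNIV d"
      using J exponents_subset_UNIV by blast
    fix P assume "P \<in> ?Z"
    then obtain i where "i < r" "P = ps ! i"
      using \<open>length ps = r\<close> by (auto simp: in_set_conv_nth)
    then show "\<rho> P \<noteq> 0 \<and> P = point (\<rho> P)"
      using \<rho> v0 pt by simp
  next
    fix c assume c: "\<And>m. m \<in> J \<Longrightarrow> (\<Sum>P\<in>?Z. c P * monomial_value (($) (\<rho> P)) m) = 0"
    have "(\<Sum>i<r. a i j * c (ps ! i)) = 0" if "j < r" for j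
    proof -
      have "\<mu> j \<in> J" using \<mu> that by (auto simp: bij_betw_def)
      then have "0 = (\<Sum>P\<in>?Z. c P * monomial_value (($) (\<rho> P)) (\<mu> j))"
        using c by simp
      also have "\<dots> = (\<Sum>i<r. c (ps ! i) * monomial_value (($) (\<rho> (ps ! i))) (\<mu> j))"
        by (rule sum.reindex_bij_betw[OF Z, symmetric])
      also have "\<dots> = (\<Sum>i<r. a i j * c (ps ! i))"
        by (rule sum.cong) (simp_all add: \<rho> a_def mult.commute)
      finally show ?thesis by simp
    qed
    then have "\<forall>i<r. c (ps ! i) = 0"
      using rows[of "\<lambda>i. c (ps ! i)"] by blast
    then show "\<forall>P\<in>?Z. c P = 0"
      using \<open>length ps = r\<close> by (auto simp: in_set_conv_nth)
  qed
  then have expected: "weddle_expected_codim d ?Z = 3"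
    using \<open>d \<ge> 2\<close> cardZ r by (intro weddle_expected_codim_eq_3) auto

  have "4 \<le> r"
  proof -
    obtain e where "d = e + 2"
      using \<open>d \<ge> 2\<close> le_Suc_ex[of 2 d] by auto
    then show ?thesis unfolding r by (simp add: eval_nat_numeral)
  qed
  let ?O = "point (axis 4 1)"
  have axis: "axis 4 1 \<noteq> (0 :: complex ^ 4)"
    by (simp add: axis_eq_0_iff)
  have axis_val: "monomial_value (($) (axis 4 1)) (\<mu> j) = 0" if "j < r" for j
  proof -
    have "Poly_Mapping.keys (\<mu> j) \<noteq> {}"
      using deg[OF that] \<open>d \<ge> 2\<close> by auto
    moreover have "Poly_Mapping.keys (\<mu> j) \<subseteq> - {4}"
      using \<mu>E[OF that] by (simp add: exponents_def)
    ultimately have "\<not> Poly_Mapping.keys (\<mu> j) \<subseteq> {4}" by blast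
    then show ?thesis by (simp add: monomial_value_axis)
  qed
  have "?O \<notin> ?Z"
  proof
    assume "?O \<in> ?Z"
    then obtain i where i: "i < r" "?O = ps ! i"
      using \<open>length ps = r\<close> by (auto simp: in_set_conv_nth)
    then have "v i \<in> line_of ?O" using v by simp
    then obtain x where x: "v i = x *s axis 4 1"
      using line_of_point[OF axis] by auto
    have "a i j = 0" if "j < r" for j
      using scale[OF that, of x "axis 4 1"] axis_val[OF that] by (simp add: a_def x)
    then show False using row_nonzero[OF i(1)] by blast
  qed
  have cardE: "card (exponents (- {4 :: 4}) d) = (d + 2) choose 2"
  proof -
    have "card (- {4 :: 4}) = 3" by (simp add: compl_4)
    then show ?thesis
      using binomial_symmetric[of 2 "d + 2"] by (simp add: exponents_card)
  qed
  have cardJ: "card J = r"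
    using bij_betw_same_card[OF \<mu>] by simp
  \<comment> \<open>The fourth coordinate point witnesses that the minimum of \<open>\<delta>\<close> is at most 2.\<close>
  have "weddle_delta d ?Z ?O \<le> card (exponents (- {4 :: 4}) d) - card J"
  proof (rule weddle_delta_axis_le[OF J])
    fix c assume c: "\<And>u. \<lbrakk>u \<noteq> 0; point u \<in> ?Z\<rbrakk> \<Longrightarrow> (\<Sum>m\<in>J. c m * monomial_value (($) u) m) = 0"
    have "(\<Sum>j<r. a i j * c (\<mu> j)) = 0" if "i < r" for i
    proof -
      have "0 = (\<Sum>m\<in>J. c m * monomial_value (($) (v i)) m)"
        using c[OF v0[OF that] inZ[OF that]] by simp
      also have "\<dots> = (\<Sum>j<r. c (\<mu> j) * monomial_value (($) (v i)) (\<mu> j))"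
        by (rule sum.reindex_bij_betw[OF \<mu>, symmetric])
      finally show ?thesis
        by (simp add: a_def mult.commute)
    qed
    then have "\<forall>j<r. c (\<mu> j) = 0"
      using cols[of "\<lambda>j. c (\<mu> j)"] by blast
    then show "\<forall>m\<in>J. c m = 0"
      using \<mu> by (auto simp: bij_betw_def)
  qed
  then have "weddle_delta d ?Z ?O \<le> 2"
    using cardE cardJ r \<open>4 \<le> r\<close> by simp
  moreover have "(INF Q\<in>- ?Z. weddle_delta d ?Z Q) \<le> weddle_delta d ?Z ?O"
    using \<open>?O \<notin> ?Z\<close> by (intro cINF_lower) auto
  ultimately have generic: "(INF Q\<in>- ?Z. weddle_delta d ?Z Q) \<le> 2" by simp

  have "v 0 \<noteq> 0" "v 1 \<noteq> 0"
    using v0 \<open>4 \<le> r\<close> by simp_all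
  moreover have "point (v 0) \<noteq> point (v 1)"
    using distinct pt[of 0] pt[of 1] \<open>4 \<le> r\<close> \<open>length ps = r\<close> nth_eq_iff_index_eq[of ps 0 1] by simp
  ultimately have v01: "v 0 \<noteq> 0" "v 1 \<noteq> 0" "point (v 0) \<noteq> point (v 1)" .
  let ?g = "\<lambda>b. point (v 0 + b *s v 1)"
  \<comment> \<open>The parameters of the points on the secant line through the first two points of \<open>Z\<close> at which
    \<open>\<delta>\<close> is bounded below; only finitely many parameters are left out.\<close>
  define T where "T = UNIV - ({0} \<union> ?g -` ?Z)"
  have "finite ({0} \<union> ?g -` ?Z)"
    using finite_vimageI[OF _ inj_line_point[OF v01], of ?Z] by simp
  then have "infinite T"
    unfolding T_def by (intro Diff_infinite_finite) (simp_all add: infinite_UNIV_char_0)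
  have "codim (zariski closure_of {P. P \<notin> ?Z \<and> weddle_delta d ?Z P > (INF Q\<in>- ?Z. weddle_delta d ?Z Q)}) \<noteq> 3"
  proof (rule codim_closure_of_line_points[OF v01 \<open>infinite T\<close>])
    fix b assume b: "b \<in> T"
    have "(d + 2) choose d < weddle_delta d ?Z (?g b) + card ?Z"
      by (rule weddle_delta_on_secant[OF v01])
        (use b inZ \<open>4 \<le> r\<close> in \<open>auto simp: T_def\<close>)
    moreover have "(d + 2) choose d = (d + 2) choose 2"
      using binomial_symmetric[of 2 "d + 2"] by simp
    ultimately have "2 < weddle_delta d ?Z (?g b)"
      using cardZ r \<open>4 \<le> r\<close> by linarith
    then show "?g b \<in> {P. P \<notin> ?Z \<and> weddle_delta d ?Z P > (INF Q\<in>- ?Z. weddle_delta d ?Z Q)}"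
      using b generic by (auto simp: T_def)
  qed
  then show ?thesis
    using distinct expected unfolding weddle_locus_def by blast
qed

theorem proposition5p7:
  fixes d N :: nat
  assumes "d \<ge> 2"
    and "N = (d + 2) choose 2"
  shows "holds_for_general_set (N - 2) (\<lambda>Z.
           weddle_expected_codim d Z = 3 \<and>
           codim (weddle_locus d Z) \<noteq> ereal (real (weddle_expected_codim d Z)))"
proof -
  define r where "r = N - 2"
  have "card (- {4 :: 4}) = 3" by (simp add: compl_4)
  then have "r \<le> card (exponents (- {4 :: 4}) d)"
    using assms(2) binomial_symmetric[of 2 "d + 2"] by (simp add: exponents_card r_def)
  then obtain J where J: "J \<subseteq> exponents (- {4 :: 4}) d" "card J = r" "finite J"
    using obtain_subset_with_card_n by blast
  obtain \<mu> where \<mu>: "bij_betw \<mu> {..<r} J"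
    using ex_bij_betw_nat_finite[OF J(3)] J(2) by (auto simp: lessThan_atLeast0)
  define F where "F = interpolation_det r \<mu>"
  have "\<mu> j \<in> exponents UNIV d" if "j < r" for j
  proof -
    have "\<mu> j \<in> exponents (- {4}) d"
      using \<mu> J(1) that by (auto simp: bij_betw_def)
    then show ?thesis
      using exponents_subset_UNIV by blast
  qed
  then have "multihomogeneous r F"
    unfolding F_def by (rule multihomogeneous_interpolation_det)
  define U where "U = {ps. length ps = r \<and> \<not> vanishes_at_tuple F ps}"
  have "openin (zariski_tuples r) U"
    unfolding zariski_tuples_def U_def
    by (rule topology_generated_by_Basis) (use \<open>multihomogeneous r F\<close> in blast)
  moreover have "U \<noteq> {}"
  proof -
    define ps where "ps = map (\<lambda>i. point (moment_point d i)) [0..<r]"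
    have "length ps = r" by (simp add: ps_def)
    moreover have "moment_point d i \<in> line_of (ps ! i)" if "i < r" for i
      using in_line_of_point[OF moment_point_nonzero, of d i] that by (simp add: ps_def)
    moreover have "eval_poly F (\<lambda>(i, k). moment_point d i $ k) \<noteq> 0"
      using moment_points_det_nonzero[OF \<mu> J(1)] by (simp add: F_def eval_interpolation_det)
    ultimately have "\<not> vanishes_at_tuple F ps"
      unfolding vanishes_at_tuple_def by auto
    then show ?thesis
      using \<open>length ps = r\<close> by (auto simp: U_def)
  qed
  moreover have "distinct ps \<and> weddle_expected_codim d (set ps) = 3 \<and>
      codim (weddle_locus d (set ps)) \<noteq> ereal (real (weddle_expected_codim d (set ps)))"
    if ps: "ps \<in> U" for ps
  proof -
    obtain v :: "nat \<Rightarrow> complex ^ 4" where v: "\<forall>i<r. v i \<in> line_of (ps ! i)"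
      "eval_poly F (\<lambda>(i, k). v i $ k) \<noteq> 0"
      using ps by (auto simp: U_def vanishes_at_tuple_def)
    have "distinct ps \<and> weddle_expected_codim d (set ps) = 3 \<and> codim (weddle_locus d (set ps)) \<noteq> 3"
    proof (rule general_points[OF assms(1) _ \<mu> J(1)])
      show "r = ((d + 2) choose 2) - 2" by (simp add: r_def assms(2))
      show "length ps = r" using ps by (simp add: U_def)
      show "v i \<in> line_of (ps ! i)" if "i < r" for i using v(1) that by blast
      show "Determinant.det (Matrix.mat r r (\<lambda>(i, j). monomial_value (($) (v i)) (\<mu> j))) \<noteq> 0"
        using v(2) by (simp add: F_def eval_interpolation_det)
    qed
    then show ?thesis by simp
  qed
  ultimately show ?thesis
    unfolding holds_for_general_set_def r_def by blast
qed

end
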